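(* Let $R=(r^1,\ldots,r^n)\in\mathbb{Z}^{n\times n}$ be such that there exists a vector $y\in\operatorname{int}(\operatorname{pos}R)\cap\operatorname{par}R$ with $$y+(\operatorname{pos}R\cap\mathbb{Z}^n)=\operatorname{int}(\operatorname{pos}R)\cap\mathbb{Z}^n.$$ Further, let $|\det R|$ have at most four (positive) divisors and let the quotient group $\mathbb{Z}^n/R\mathbb{Z}^n$ be cyclic. Then $$\operatorname{ICR}(\operatorname{pos}R)=n.$$
   Context: For a matrix $R$ with columns $r^1,\ldots,r^n$, $\operatorname{pos}R$ denotes the set of all non-negative real linear combinations of the columns, and $$\operatorname{par}R:=\Big\{x\in\mathbb{R}^n : x=\sum_{i=1}^n\lambda_i r^i,\ \lambda_i\in[0,1)\text{ for all }i\Big\}\cap\mathbb{Z}^n$$ is the set of integer vectors in the half-open parallelepiped spanned by the columns. $\operatorname{int}X$ is the interior of $X$. $\mathbb{N}$ denotes the non-negative integers. For a pointed rational cone $C\subseteq\mathbb{R}^n$, the Hilbert basis $\mathcal{H}(C)$ is the unique minimal set of vectors in $C\cap\mathbb{Z}^n$ such that every element of $C\cap\mathbb{Z}^n$ is a non-negative integral combination of elements of the set (it is finite). The integer Carathéodory rank of $C$ is $$\operatorname{ICR}(C):=\max_{z\in C\cap\mathbb{Z}^n}\min\Big\{k : z=\sum_{i=1}^k\lambda_i h^i\text{ with }\lambda_i\in\mathbb{N},\ h^i\in\mathcal{H}(C)\text{ for all }i\in\{1,\ldots,k\}\Big\}.$$ *)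

theory Defs
  imports "HOL-Analysis.Analysis" "HOL-Algebra.Elementary_Groups" "HOL-Library.Extended_Nat"
begin

definition int_points :: "(real ^ 'n) set" where
  "int_points = {x. \<forall>i. x $ i \<in> \<int>}"

abbreviation real_mat :: "int ^ 'n ^ 'm \<Rightarrow> real ^ 'n ^ 'm" where
  "real_mat \<equiv> map_matrix real_of_int"

definition pos :: "real ^ 'n ^ 'm \<Rightarrow> (real ^ 'm) set" where
  "pos R = {x. \<exists>l. (\<forall>i. 0 \<le> l i) \<and> x = (\<Sum>i\<in>UNIV. l i *\<^sub>R column i R)}"

definition par :: "real ^ 'n ^ 'm \<Rightarrow> (real ^ 'm) set" where
  "par R = {x. \<exists>l. (\<forall>i. l i \<in> {0..<1}) \<and> x = (\<Sum>i\<in>UNIV. l i *\<^sub>R column i R)} \<inter> int_points"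

definition nat_combinations :: "(real ^ 'n) set \<Rightarrow> (real ^ 'n) set" where
  "nat_combinations H =
     {x. \<exists>F (c :: real ^ 'n \<Rightarrow> nat). finite F \<and> F \<subseteq> H \<and> x = (\<Sum>h\<in>F. real (c h) *\<^sub>R h)}"

definition generates_int_points :: "(real ^ 'n) set \<Rightarrow> (real ^ 'n) set \<Rightarrow> bool" where
  "generates_int_points H C \<longleftrightarrow> H \<subseteq> C \<inter> int_points \<and> C \<inter> int_points \<subseteq> nat_combinations H"

text \<open>Minimality is with respect to inclusion. The minimal set exists and is unique for pointed
  rational cones; for other sets \<open>hilbert_basis\<close> may be unspecified.\<close>

definition hilbert_basis :: "(real ^ 'n) set \<Rightarrow> (real ^ 'n) set" where
  "hilbert_basis C =
     (THE H. generates_int_points H C \<and> (\<forall>H'. H' \<subset> H \<longrightarrow> \<not> generates_int_points H' C))"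

text \<open>Values are in \<^typ>\<open>enat\<close>, so that the infimum over an empty set of lengths and the supremum
  of an unbounded set are infinite. For a nonempty set of integer points, a finite supremum
  in \<^typ>\<open>enat\<close> is attained, hence a maximum.\<close>

definition icr :: "(real ^ 'n) set \<Rightarrow> enat" where
  "icr C = (SUP z \<in> C \<inter> int_points.
     INF k \<in> {k. \<exists>(l :: nat \<Rightarrow> nat) h. (\<forall>i\<in>{1..k}. h i \<in> hilbert_basis C) \<and>
                   z = (\<Sum>i = 1..k. real (l i) *\<^sub>R h i)}. enat k)"

definition int_vec_group :: "(int ^ 'n) monoid" where
  "int_vec_group = \<lparr>carrier = UNIV, mult = (+), one = 0\<rparr>"

definition lattice_quotient :: "int ^ 'n ^ 'n \<Rightarrow> (int ^ 'n) set monoid" where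
  "lattice_quotient R = int_vec_group Mod range (\<lambda>z. R *v z)"

end

theory Submission
  imports Defs
begin

text \<open>Write integer points of \<open>pos R\<close> in the coordinates \<open>R\<^sup>-\<^sup>1 x\<close>, multiplied by \<open>D = \<bar>det R\<bar>\<close>
to make them integral. The cone becomes the nonnegative orthant and the integer points become a
lattice \<open>L\<close> containing \<open>D \<int>\<^sup>n\<close>; let \<open>d\<close> be the image of \<open>y\<close>. The shift hypothesis makes \<open>d\<close>
the least point of \<open>L\<close> in the open orthant, which forces \<open>d\<^sub>i\<close> to divide the \<open>i\<close>-th coordinate of
every point of \<open>L\<close>, in particular \<open>D\<close>. So in each coordinate \<open>d\<close> generates what all of \<open>L\<close>
generates; since \<open>L / D \<int>\<^sup>n\<close>, a copy of \<open>\<int>\<^sup>n / R \<int>\<^sup>n\<close>, is cyclic, this can only happen if \<open>d\<close> itself generates it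
(\<open>divisor_generates_cyclic\<close>). Hence \<open>L\<close> consists of the vectors congruent modulo \<open>D\<close> to a multiple
of \<open>d\<close>, and any two coordinates at which \<open>d\<close> agrees are congruent modulo \<open>D\<close> at every point of \<open>L\<close>.

The divisor hypothesis says only how many such classes of coordinates there are: the \<open>d\<^sub>i\<close> are
divisors of \<open>D\<close> other than \<open>D\<close>, so they take at most three values, and if they take three then one of
them is 1.

With at most two values and \<open>n > 1\<close>, there are two classes of coordinates, after splitting a single
class if necessary. Subtract from a point \<open>z\<close> the largest vector that is constant on both classes,
zero elsewhere, and leaves a nonnegative rest. The rest lies in \<open>D \<int>\<^sup>n\<close> and vanishes at one coordinate of each class, so
\<open>n - 2\<close> multiples of irreducible points on the axes produce it. The subtracted part lives in a planar
lattice, where the classical two-dimensional theorem represents it by two irreducible points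
(\<open>planar_two_irreducibles\<close>): in total \<open>n\<close>. This is \<open>two_blocks_few_multiples\<close>.

With three values the entry 1 makes \<open>d\<close> irreducible. Subtract \<open>d\<close> as often as possible; some coordinate
\<open>i\<close> drops to 0, so the rest is divisible by \<open>D\<close> on the whole class of \<open>i\<close>, and the case of two classes
applies to the others, while coordinate \<open>i\<close> costs nothing. This compensates for the use of \<open>d\<close>.

Since every point is a combination of irreducible points, these form the Hilbert basis and the rank is
at most \<open>n\<close>. It is at least \<open>n\<close> because the Hilbert basis is finite: fewer than \<open>n\<close> of its elements
span a proper subspace, and finitely many proper subspaces cannot cover the moment curve.\<close>

section \<open>Irreducible elements and sums of few multiples\<close>

definition irreducibles :: "'a::monoid_add set \<Rightarrow> 'a set" where
  "irreducibles M = {h \<in> M. h \<noteq> 0 \<and> (\<forall>v\<in>M. \<forall>w\<in>M. h = v + w \<longrightarrow> v = 0 \<or> w = 0)}"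

text \<open>Multiples of the same element are merged, so \<open>k\<close> bounds the number of distinct elements involved.
Scaling by natural numbers through \<open>of_nat\<close> serves integer and real vectors alike.\<close>

definition few_multiples :: "('a::comm_ring_1 ^ 'n) set \<Rightarrow> nat \<Rightarrow> 'a ^ 'n \<Rightarrow> bool" where
  "few_multiples H k z \<longleftrightarrow>
     (\<exists>S c. finite S \<and> S \<subseteq> H \<and> card S \<le> k \<and> z = (\<Sum>h\<in>S. of_nat (c h) *s h))"

lemma few_multiples_zero: "few_multiples H 0 0"
  unfolding few_multiples_def by (intro exI[of _ "{}"]) auto

lemma few_multiples_mono: "few_multiples H k z \<Longrightarrow> k \<le> l \<Longrightarrow> few_multiples H l z"
  unfolding few_multiples_def using le_trans by blast

lemma few_multiples_single: "h \<in> H \<Longrightarrow> few_multiples H 1 (of_nat c *s h)"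
  unfolding few_multiples_def by (intro exI[of _ "{h}"] exI[of _ "\<lambda>_. c"]) auto

lemma few_multiples_add:
  assumes "few_multiples H k x" "few_multiples H l y"
  shows "few_multiples H (k + l) (x + y)"
proof -
  obtain S c where S: "finite S" "S \<subseteq> H" "card S \<le> k" "x = (\<Sum>h\<in>S. of_nat (c h) *s h)"
    using assms(1) by (auto simp: few_multiples_def)
  obtain T e where T: "finite T" "T \<subseteq> H" "card T \<le> l" "y = (\<Sum>h\<in>T. of_nat (e h) *s h)"
    using assms(2) by (auto simp: few_multiples_def)
  define g where "g h = (if h \<in> S then c h else 0) + (if h \<in> T then e h else 0)" for h
  have "x = (\<Sum>h\<in>S \<union> T. of_nat (if h \<in> S then c h else 0) *s h)"
    unfolding S(4) using S(1) T(1) by (intro sum.mono_neutral_cong_left) auto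
  moreover have "y = (\<Sum>h\<in>S \<union> T. of_nat (if h \<in> T then e h else 0) *s h)"
    unfolding T(4) using S(1) T(1) by (intro sum.mono_neutral_cong_left) auto
  ultimately have "x + y = (\<Sum>h\<in>S \<union> T. of_nat (g h) *s h)"
    by (simp add: g_def sum.distrib[symmetric] vector_sadd_rdistrib)
  moreover have "card (S \<union> T) \<le> k + l" using card_Un_le[of S T] S(3) T(3) by linarith
  ultimately show ?thesis unfolding few_multiples_def using S T by blast
qed

lemma few_multiples_sum:
  assumes "finite I" "\<And>i. i \<in> I \<Longrightarrow> few_multiples H 1 (f i)"
  shows "few_multiples H (card I) (sum f I)"
  using assms
proof (induction I rule: finite_induct)
  case empty
  then show ?case using few_multiples_zero by simp
next
  case (insert i I)
  then show ?case using few_multiples_add[of H 1 "f i" "card I" "sum f I"] by simp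
qed

lemma irreducibles_image:
  fixes f :: "'a::ab_group_add \<Rightarrow> 'b::ab_group_add"
  assumes add: "\<And>x y. f (x + y) = f x + f y" and inj: "inj f"
  shows "irreducibles (f ` M) = f ` irreducibles M"
proof -
  have "f 0 = 0" using add[of 0 0] by simp
  then have zero: "f x = 0 \<longleftrightarrow> x = 0" for x using inj_eq[OF inj, of x 0] by simp
  have eq: "f x = f v + f w \<longleftrightarrow> x = v + w" for x v w
    using inj_eq[OF inj, of x "v + w"] by (simp add: add)
  show ?thesis unfolding irreducibles_def by (auto simp: zero eq)
qed

lemma few_multiples_image:
  fixes f :: "'a::comm_ring_1 ^ 'n \<Rightarrow> 'b::comm_ring_1 ^ 'm"
  assumes add: "\<And>x y. f (x + y) = f x + f y" and inj: "inj f" and z: "few_multiples H k z"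
  shows "few_multiples (f ` H) k (f z)"
proof -
  obtain S c where S: "finite S" "S \<subseteq> H" "card S \<le> k" "z = (\<Sum>h\<in>S. of_nat (c h) *s h)"
    using z by (auto simp: few_multiples_def)
  have f0: "f 0 = 0" using add[of 0 0] by simp
  have scale: "f (of_nat m *s x) = of_nat m *s f x" for m x
    by (induction m) (auto simp: f0 add vector_sadd_rdistrib)
  have "f z = (\<Sum>h\<in>S. f (of_nat (c h) *s h))"
    unfolding S(4) using S(1) by (induction S rule: finite_induct) (auto simp: f0 add)
  also have "\<dots> = (\<Sum>h\<in>f ` S. of_nat (c (inv_into UNIV f h)) *s h)"
    by (subst sum.reindex) (simp_all add: scale inv_f_f[OF inj] inj_on_subset[OF inj])
  finally show ?thesis unfolding few_multiples_def
    using S card_image_le[OF S(1), of f] by (intro exI[of _ "f ` S"] exI[of _ "\<lambda>h. c (inv_into UNIV f h)"]) auto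
qed

section \<open>Two irreducible elements suffice in the plane\<close>

definition quadrant_part :: "(int \<times> int) set \<Rightarrow> (int \<times> int) set" where
  "quadrant_part G = {(x, y) \<in> G. 0 \<le> x \<and> 0 \<le> y}"

lemma planar_multiple_mem:
  fixes G :: "(int \<times> int) set"
  assumes diff: "\<And>X Y. X \<in> G \<Longrightarrow> Y \<in> G \<Longrightarrow> X - Y \<in> G" and "(x, y) \<in> G"
  shows "(q * x, q * y) \<in> G"
proof (induction q rule: int_induct[of _ 0])
  case base
  show ?case using diff[OF assms(2) assms(2)] by (simp add: zero_prod_def)
next
  case (step1 i)
  have "(0, 0) - (x, y) \<in> G"
    using diff[OF diff[OF assms(2) assms(2)] assms(2)] by (simp add: zero_prod_def)
  from diff[OF step1(2) this] show ?case by (simp add: algebra_simps)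
next
  case (step2 i)
  from diff[OF step2(2) assms(2)] show ?case by (simp add: algebra_simps)
qed

text \<open>Write a decomposition of the basis vector as \<open>v = q h + r h'\<close> and \<open>w = (1 - q) h - r h'\<close>. If
\<open>r > 0\<close>, adding a suitable nonnegative multiple of \<open>h\<close> to \<open>v\<close> or to \<open>w\<close> gives a positive multiple of
\<open>h' - h\<close> or of \<open>h - h'\<close>; so one of the two differences would be nonnegative. The case \<open>r < 0\<close> exchanges \<open>v\<close> and \<open>w\<close>, and for
\<open>r = 0\<close> both summands are nonnegative multiples of \<open>h\<close>, so one of them is 0.\<close>

lemma irreducible_basis_vector:
  fixes G :: "(int \<times> int) set"
  assumes h: "(a, b) \<in> quadrant_part G" "(a, b) \<noteq> 0"
    and h': "(a', b') \<in> quadrant_part G"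
    and basis: "\<And>x y. (x, y) \<in> G \<Longrightarrow> \<exists>q r. x = q * a + r * a' \<and> y = q * b + r * b'"
    and incomparable: "\<not> (a \<le> a' \<and> b \<le> b')" "\<not> (a' \<le> a \<and> b' \<le> b)"
  shows "(a, b) \<in> irreducibles (quadrant_part G)"
proof -
  have nonneg: "0 \<le> a" "0 \<le> b" using h by (auto simp: quadrant_part_def)
  have positive_case: False
    if v: "0 \<le> r * a' - m * a" "0 \<le> r * b' - m * b"
      and w: "0 \<le> (1 + m) * a - r * a'" "0 \<le> (1 + m) * b - r * b'" and "0 < r" for m r :: int
  proof (cases "1 + m \<le> r")
    case True
    then have "0 \<le> (r - 1 - m) * a" "0 \<le> (r - 1 - m) * b" using nonneg by auto
    with w have "0 \<le> r * (a - a')" "0 \<le> r * (b - b')" by (simp_all add: algebra_simps)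
    then show False using \<open>0 < r\<close> incomparable(2) by (simp add: zero_le_mult_iff)
  next
    case False
    then have "0 \<le> (m - r) * a" "0 \<le> (m - r) * b" using nonneg by auto
    with v have "0 \<le> r * (a' - a)" "0 \<le> r * (b' - b)" by (simp_all add: algebra_simps)
    then show False using \<open>0 < r\<close> incomparable(1) by (simp add: zero_le_mult_iff)
  qed
  have "v = 0 \<or> w = 0" if vw: "v \<in> quadrant_part G" "w \<in> quadrant_part G" "(a, b) = v + w" for v w
  proof -
    obtain v1 v2 where v: "v = (v1, v2)" "(v1, v2) \<in> G" "0 \<le> v1" "0 \<le> v2"
      using vw(1) by (auto simp: quadrant_part_def)
    obtain w1 w2 where w: "w = (w1, w2)" "(w1, w2) \<in> G" "0 \<le> w1" "0 \<le> w2"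
      using vw(2) by (auto simp: quadrant_part_def)
    have sum: "a = v1 + w1" "b = v2 + w2" using vw(3) v w by auto
    obtain q r where qr: "v1 = q * a + r * a'" "v2 = q * b + r * b'" using basis[OF v(2)] by blast
    have w': "w1 = (1 - q) * a - r * a'" "w2 = (1 - q) * b - r * b'"
      using sum qr by (simp_all add: algebra_simps)
    consider "0 < r" | "r < 0" | "r = 0" by linarith
    then show ?thesis
    proof cases
      case 1
      then show ?thesis using positive_case[of r "- q"] v w qr w' by (simp add: algebra_simps)
    next
      case 2
      then show ?thesis using positive_case[of "- r" "q - 1"] v w qr w' by (simp add: algebra_simps)
    next
      case 3
      have "q * a \<ge> 0" "q * b \<ge> 0" "(1 - q) * a \<ge> 0" "(1 - q) * b \<ge> 0"
        using v w qr w' 3 by auto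
      moreover have "a > 0 \<or> b > 0" using h(2) nonneg by (auto simp: zero_prod_def)
      ultimately have "q \<ge> 0 \<and> 1 - q \<ge> 0" by (auto simp: zero_le_mult_iff)
      then have "q = 0 \<or> q = 1" by linarith
      then show ?thesis using v w qr w' 3 by (auto simp: zero_prod_def)
    qed
  qed
  then show ?thesis using h by (auto simp: irreducibles_def)
qed

text \<open>Among the pairs of points spanning a cone that contains the given point, take one spanning the least
area, and then one with the least coordinate sum. Least area makes the pair a basis of the lattice, since
a further lattice point in the parallelogram would split the cone into cones of smaller area. Least sum makes
the two points incomparable, since \<open>h\<close> could otherwise be replaced by \<open>h - h'\<close>, or \<open>h'\<close> by \<open>h' - h\<close>;
hence both points are irreducible by the previous lemma.\<close>

lemma planar_two_irreducibles:
  fixes G :: "(int \<times> int) set"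
  assumes diff: "\<And>X Y. X \<in> G \<Longrightarrow> Y \<in> G \<Longrightarrow> X - Y \<in> G"
    and D: "0 < D" "(D, 0) \<in> G" "(0, D) \<in> G"
    and P: "(p1, p2) \<in> quadrant_part G"
  obtains a b a' b' and s s' :: nat
  where "(a, b) \<in> irreducibles (quadrant_part G)" "(a', b') \<in> irreducibles (quadrant_part G)"
    and "p1 = int s * a + int s' * a'" "p2 = int s * b + int s' * b'"
proof -
  \<comment> \<open>a pair of points \<open>(a, b)\<close>, \<open>(a', b')\<close> in counterclockwise order whose cone contains \<open>(p1, p2)\<close>\<close>
  define admissible where "admissible = (\<lambda>(a, b, a', b').
    (a, b) \<in> quadrant_part G \<and> (a', b') \<in> quadrant_part G \<and> 0 < a * b' - a' * b \<and>
    0 \<le> p1 * b' - a' * p2 \<and> 0 \<le> a * p2 - p1 * b)"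
  define area where "area = (\<lambda>(a, b, a', b'). nat (a * b' - a' * b :: int))"
  define size where "size = (\<lambda>(a, b, a', b'). nat (a + b + a' + b' :: int))"
  have "admissible (D, 0, 0, D)"
    using D P by (auto simp: admissible_def quadrant_part_def)
  then obtain T0 where T0: "admissible T0" "\<And>T. admissible T \<Longrightarrow> area T0 \<le> area T"
    using ex_has_least_nat[of admissible _ area] by blast
  then obtain T where T: "admissible T" "area T = area T0"
    "\<And>T'. admissible T' \<Longrightarrow> area T' = area T0 \<Longrightarrow> size T \<le> size T'"
    using ex_has_least_nat[of "\<lambda>T. admissible T \<and> area T = area T0" _ size] by blast
  obtain a b a' b' where T_eq: "T = (a, b, a', b')" by (cases T)
  define d where "d = a * b' - a' * b"
  have h: "(a, b) \<in> G" "0 \<le> a" "0 \<le> b" and h': "(a', b') \<in> G" "0 \<le> a'" "0 \<le> b'" and "0 < d"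
    and cone: "0 \<le> p1 * b' - a' * p2" "0 \<le> a * p2 - p1 * b"
    using T(1) by (auto simp: T_eq admissible_def quadrant_part_def d_def)
  have area_min: "d \<le> x * y' - x' * y" if "admissible (x, y, x', y')" for x y x' y'
    using T0(2)[OF that] T(2) that \<open>0 < d\<close>
    by (simp add: T_eq area_def d_def[symmetric] admissible_def)
  have size_min: "a + b + a' + b' \<le> x + y + x' + y'"
    if "admissible (x, y, x', y')" "x * y' - x' * y = d" for x y x' y'
    using T(3)[OF that(1)] T(2) that
    by (auto simp: T_eq area_def size_def d_def admissible_def quadrant_part_def)
  have basis: "\<exists>q r. x = q * a + r * a' \<and> y = q * b + r * b'" if xy: "(x, y) \<in> G" for x y
  proof -
    define q where "q = (x * b' - a' * y) div d"
    define r where "r = (a * y - x * b) div d"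
    define e where "e = (x * b' - a' * y) mod d"
    define f where "f = (a * y - x * b) mod d"
    have ef: "0 \<le> e" "e < d" "0 \<le> f" "f < d" using \<open>0 < d\<close> by (auto simp: e_def f_def)
    have q: "x * b' - a' * y = d * q + e" and r: "a * y - x * b = d * r + f"
      by (simp_all add: q_def r_def e_def f_def)
    \<comment> \<open>the point \<open>(u, v)\<close> is \<open>(x, y)\<close> moved into the half-open parallelogram of the pair\<close>
    define u where "u = x - q * a - r * a'"
    define v where "v = y - q * b - r * b'"
    have "(u, v) \<in> G"
      using diff[OF diff[OF xy planar_multiple_mem[OF diff h(1), of q]]
          planar_multiple_mem[OF diff h'(1), of r]]
      by (simp add: u_def v_def)
    have e_eq: "u * b' - a' * v = e" and f_eq: "a * v - u * b = f"
      using q r by (simp_all add: u_def v_def d_def algebra_simps)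
    have du: "d * u = e * a + f * a'" and dv: "d * v = e * b + f * b'"
      unfolding d_def e_eq[symmetric] f_eq[symmetric] by (simp_all add: algebra_simps)
    have "0 \<le> d * u" "0 \<le> d * v" unfolding du dv using ef h h' by auto
    then have uv: "(u, v) \<in> quadrant_part G"
      using \<open>0 < d\<close> \<open>(u, v) \<in> G\<close> by (auto simp: quadrant_part_def zero_le_mult_iff)
    have "d * (p1 * v - u * p2) = p1 * (d * v) - (d * u) * p2"
      by (simp add: algebra_simps)
    then have P_side: "d * (p1 * v - u * p2) = f * (p1 * b' - a' * p2) - e * (a * p2 - p1 * b)"
      unfolding du dv by (simp add: algebra_simps)
    have "e = 0 \<and> f = 0"
    proof (rule ccontr)
      assume nonzero: "\<not> (e = 0 \<and> f = 0)"
      \<comment> \<open>the point \<open>(u, v)\<close> splits the cone in two; the half containing \<open>(p1, p2)\<close> has smaller area\<close>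
      have "admissible (a, b, u, v) \<or> admissible (u, v, a', b')"
      proof (cases "0 < f \<and> 0 \<le> p1 * v - u * p2")
        case True
        then show ?thesis using h uv cone f_eq by (auto simp: admissible_def quadrant_part_def)
      next
        case False
        have "p1 * v - u * p2 \<le> 0"
        proof (cases "0 < f")
          case True
          with False show ?thesis by linarith
        next
          case f0: False
          then have "d * (p1 * v - u * p2) \<le> 0" using P_side ef cone by simp
          then show ?thesis using \<open>0 < d\<close> by (simp add: mult_le_0_iff)
        qed
        moreover have "0 < e"
        proof (rule ccontr)
          assume "\<not> 0 < e"
          with nonzero ef have "e = 0" "0 < f" by auto
          then have "0 \<le> d * (p1 * v - u * p2)" using P_side cone by simp
          then show False using False \<open>0 < f\<close> \<open>0 < d\<close> by (simp add: zero_le_mult_iff)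
        qed
        ultimately show ?thesis using h' uv cone e_eq
          by (auto simp: admissible_def quadrant_part_def algebra_simps)
      qed
      then have "d \<le> e \<or> d \<le> f" using area_min e_eq f_eq by blast
      then show False using ef by linarith
    qed
    then have "u = 0" "v = 0" using du dv \<open>0 < d\<close> by auto
    then show ?thesis unfolding u_def v_def by (intro exI[of _ q] exI[of _ r]) simp
  qed
  have h0: "a + b > 0" "a' + b' > 0"
    using h h' \<open>0 < d\<close> unfolding d_def
    by (smt (verit) mult_eq_0_iff mult_zero_left)+
  have inc1: "\<not> (a \<le> a' \<and> b \<le> b')"
  proof
    assume "a \<le> a' \<and> b \<le> b'"
    then have "admissible (a, b, a' - a, b' - b)"
      using h h' cone diff[OF h'(1) h(1)] \<open>0 < d\<close>
      by (auto simp: admissible_def quadrant_part_def d_def algebra_simps)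
    from size_min[OF this] h0 show False by (simp add: d_def algebra_simps)
  qed
  have inc2: "\<not> (a' \<le> a \<and> b' \<le> b)"
  proof
    assume "a' \<le> a \<and> b' \<le> b"
    then have "admissible (a - a', b - b', a', b')"
      using h h' cone diff[OF h(1) h'(1)] \<open>0 < d\<close>
      by (auto simp: admissible_def quadrant_part_def d_def algebra_simps)
    from size_min[OF this] h0 show False by (simp add: d_def algebra_simps)
  qed
  have "(a, b) \<in> irreducibles (quadrant_part G)"
    by (rule irreducible_basis_vector[of _ _ _ a' b'])
      (use h h' h0 basis inc1 inc2 in \<open>auto simp: quadrant_part_def zero_prod_def\<close>)
  moreover have "\<exists>q r. x = q * a' + r * a \<and> y = q * b' + r * b" if "(x, y) \<in> G" for x y
    using basis[OF that] by (metis add.commute)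
  then have "(a', b') \<in> irreducibles (quadrant_part G)"
    by (intro irreducible_basis_vector[of _ _ _ a b])
      (use h h' h0 inc1 inc2 in \<open>auto simp: quadrant_part_def zero_prod_def\<close>)
  moreover obtain q r where qr: "p1 = q * a + r * a'" "p2 = q * b + r * b'"
    using basis[of p1 p2] P by (auto simp: quadrant_part_def)
  have "0 \<le> q * d" "0 \<le> r * d" using cone unfolding qr d_def by (simp_all add: algebra_simps)
  then have "0 \<le> q" "0 \<le> r" using \<open>0 < d\<close> by (auto simp: zero_le_mult_iff)
  then have "p1 = int (nat q) * a + int (nat r) * a'" "p2 = int (nat q) * b + int (nat r) * b'"
    using qr by auto
  ultimately show ?thesis using that by blast
qed

section \<open>Cones of integer points generated by one vector modulo D\<close>

text \<open>The integer points of the cone in coordinates scaled by \<open>D\<close>: \<open>d\<close> stands for the shift vector, and the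
lattice is generated by \<open>d\<close> and \<open>D \<int>\<^sup>n\<close>.\<close>

locale diagonal_lattice =
  fixes D :: int and d :: "int ^ 'n"
  assumes d_pos: "0 < d $ i" and d_less: "d $ i < D" and d_dvd: "d $ i dvd D"
begin

definition lattice :: "(int ^ 'n) set" where
  "lattice = {x. \<exists>k. \<forall>i. D dvd x $ i - k * d $ i}"

definition cone_points :: "(int ^ 'n) set" where
  "cone_points = {x \<in> lattice. \<forall>i. 0 \<le> x $ i}"

lemma D_pos: "0 < D"
  using d_pos d_less less_trans by blast

lemma lattice_diff: "x \<in> lattice \<Longrightarrow> y \<in> lattice \<Longrightarrow> x - y \<in> lattice"
proof -
  assume "x \<in> lattice" "y \<in> lattice"
  then obtain k l where k: "\<And>i. D dvd x $ i - k * d $ i" and l: "\<And>i. D dvd y $ i - l * d $ i"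
    by (auto simp: lattice_def)
  have "D dvd (x - y) $ i - (k - l) * d $ i" for i
    using dvd_diff[OF k l, of i i] by (simp add: algebra_simps)
  then show ?thesis unfolding lattice_def by blast
qed

lemma lattice_integral: "(\<And>i. D dvd x $ i) \<Longrightarrow> x \<in> lattice"
  unfolding lattice_def by (auto intro!: exI[of _ 0])

lemma lattice_add: "x \<in> lattice \<Longrightarrow> y \<in> lattice \<Longrightarrow> x + y \<in> lattice"
  using lattice_diff[OF _ lattice_diff[OF lattice_integral[of 0], of y], of x] by simp

lemma lattice_scale: "x \<in> lattice \<Longrightarrow> a *s x \<in> lattice"
proof -
  assume "x \<in> lattice"
  then obtain k where k: "\<And>i. D dvd x $ i - k * d $ i"
    by (auto simp: lattice_def)
  have "D dvd (a *s x) $ i - (a * k) * d $ i" for i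
    using dvd_mult[OF k, of a i] by (simp add: algebra_simps)
  then show ?thesis unfolding lattice_def by blast
qed

lemma d_dvd_lattice: "x \<in> lattice \<Longrightarrow> d $ i dvd x $ i"
  by (auto simp: lattice_def) (metis d_dvd dvd_diff_commute dvd_diff_right_iff dvd_trans dvd_triv_right)

lemma lattice_cong:
  assumes "x \<in> lattice" "d $ i = d $ j"
  shows "D dvd x $ i - x $ j"
proof -
  obtain k where k: "\<And>i. D dvd x $ i - k * d $ i" using assms by (auto simp: lattice_def)
  show ?thesis using dvd_diff[OF k[of i] k[of j]] assms(2) by simp
qed

lemma cong_imp_eq:
  assumes "D dvd a - b" "0 \<le> a" "a < D" "0 \<le> b" "b < D" shows "a = b"
proof -
  have "\<bar>a - b\<bar> < D" using assms by linarith
  then show ?thesis using assms(1) dvd_imp_le_int[of "a - b" D] by fastforce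
qed

text \<open>The lattice points on a coordinate axis are the multiples of the first positive one, which is
irreducible because the summands of a point on the axis stay on the axis.\<close>

lemma axis_few_multiples:
  assumes "axis i a \<in> cone_points"
  shows "few_multiples (irreducibles cone_points) 1 (axis i a)"
proof (cases "a = 0")
  case True
  then have "axis i a = 0" by (simp add: axis_def vec_eq_iff)
  then show ?thesis using few_multiples_mono[OF few_multiples_zero zero_le_one] by metis
next
  case False
  have nonneg: "0 \<le> a" using assms by (auto simp: cone_points_def axis_def split: if_splits)
  define k where "k = (LEAST k::nat. 0 < k \<and> axis i (int k) \<in> lattice)"
  have ex: "0 < nat a \<and> axis i (int (nat a)) \<in> lattice"
    using assms nonneg False by (auto simp: cone_points_def)
  have k: "0 < k" "axis i (int k) \<in> lattice"
    using LeastI[of "\<lambda>k::nat. 0 < k \<and> axis i (int k) \<in> lattice", OF ex] by (auto simp: k_def)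
  have least: "m = 0" if "axis i m \<in> lattice" "0 \<le> m" "m < int k" for m
    using not_less_Least[of "nat m" "\<lambda>k::nat. 0 < k \<and> axis i (int k) \<in> lattice"] that
    by (auto simp: k_def[symmetric])
  have "axis i (a mod int k) = axis i a - (a div int k) *s axis i (int k)"
    by (auto simp: axis_def vec_eq_iff minus_div_mult_eq_mod)
  also have "\<dots> \<in> lattice"
    using assms k by (intro lattice_diff lattice_scale) (auto simp: cone_points_def)
  finally have "a mod int k = 0" using k(1) by (intro least) auto
  then have a: "a = int (nat (a div int k)) * int k"
    using nonneg k(1) div_mult_mod_eq[of a "int k"] by (simp add: pos_imp_zdiv_nonneg_iff)
  have "v = 0 \<or> w = 0" if vw: "v \<in> cone_points" "w \<in> cone_points" "axis i (int k) = v + w" for v w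
  proof -
    have comp: "v $ j + w $ j = (if j = i then int k else 0)" for j
      using arg_cong[OF vw(3), of "\<lambda>x. x $ j"] by (auto simp: axis_def)
    have nn: "0 \<le> v $ j" "0 \<le> w $ j" for j using vw by (auto simp: cone_points_def)
    have off: "v $ j = 0" "w $ j = 0" if "j \<noteq> i" for j
      using comp[of j] nn[of j] that by auto
    have v: "v = axis i (v $ i)" using off by (auto simp: axis_def vec_eq_iff)
    have "v $ i = 0 \<or> v $ i = int k"
      using least[of "v $ i"] v vw(1) nn[of i] comp[of i] by (auto simp: cone_points_def)
    then have "(\<forall>j. v $ j = 0) \<or> (\<forall>j. w $ j = 0)"
      using off comp[of i] by (metis add_0 add_left_imp_eq add.right_neutral)
    then show ?thesis by (auto simp: vec_eq_iff)
  qed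
  moreover have "axis i (int k) \<noteq> 0" using k(1) by (simp add: axis_eq_0_iff)
  moreover have "axis i (int k) \<in> cone_points" using k(2) by (simp add: cone_points_def axis_def)
  ultimately have "axis i (int k) \<in> irreducibles cone_points"
    unfolding irreducibles_def by blast
  from few_multiples_single[OF this, of "nat (a div int k)"]
  have "few_multiples (irreducibles cone_points) 1 (of_nat (nat (a div int k)) *s axis i (int k))" .
  also have "of_nat (nat (a div int k)) *s axis i (int k) = axis i a"
    using a by (auto simp: axis_def vec_eq_iff)
  finally show ?thesis .
qed

lemma integral_few_multiples:
  assumes "\<And>i. 0 \<le> x $ i" "\<And>i. D dvd x $ i"
  shows "few_multiples (irreducibles cone_points) (card {i. x $ i \<noteq> 0}) x"
proof -
  have "axis i (x $ i) \<in> cone_points" for i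
    using assms unfolding cone_points_def
    by (auto intro!: lattice_integral simp: axis_def)
  then have "few_multiples (irreducibles cone_points) (card {i. x $ i \<noteq> 0})
      (\<Sum>i | x $ i \<noteq> 0. axis i (x $ i))"
    by (intro few_multiples_sum axis_few_multiples) auto
  also have "(\<Sum>i | x $ i \<noteq> 0. axis i (x $ i)) = x"
    by (auto simp: vec_eq_iff axis_def)
  finally show ?thesis .
qed

text \<open>At a coordinate where \<open>d\<close> is 1, one of two summands vanishes. A lattice point vanishing there is
congruent to a multiple \<open>k d\<close> with \<open>D dvd k\<close>, hence is divisible by \<open>D\<close>; being bounded by \<open>d\<close>, it is 0.\<close>

lemma generator_irreducible:
  assumes "d $ i = 1"
  shows "d \<in> irreducibles cone_points"
proof -
  have "d \<in> cone_points"
    by (auto simp: cone_points_def lattice_def less_imp_le[OF d_pos] intro!: exI[of _ 1])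
  moreover have "d \<noteq> 0" using d_pos[of i] by auto
  moreover have zero: "v = 0"
    if v: "v \<in> cone_points" "v $ i = 0" "\<And>j. v $ j \<le> d $ j" for v
  proof -
    obtain k where k: "\<And>j. D dvd v $ j - k * d $ j"
      using v by (auto simp: cone_points_def lattice_def)
    have "D dvd k" using k[of i] assms v(2) by simp
    then have "D dvd v $ j" for j using k[of j] by (metis dvd_diff_left_iff dvd_mult2)
    moreover have "0 \<le> v $ j" "v $ j < D" for j
      using v(1) v(3)[of j] d_less[of j] by (auto simp: cone_points_def)
    ultimately have "v $ j = 0" for j by (metis cong_imp_eq D_pos diff_zero order_refl)
    then show ?thesis by (simp add: vec_eq_iff)
  qed
  moreover have "v = 0 \<or> w = 0" if vw: "v \<in> cone_points" "w \<in> cone_points" "d = v + w" for v w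
  proof -
    have comp: "d $ j = v $ j + w $ j" for j using vw(3) by simp
    have nn: "0 \<le> v $ j" "0 \<le> w $ j" for j using vw(1,2) by (auto simp: cone_points_def)
    have "v $ i = 0 \<or> w $ i = 0" using comp[of i] nn[of i] assms by linarith
    moreover have "v $ j \<le> d $ j" "w $ j \<le> d $ j" for j using comp[of j] nn[of j] by auto
    ultimately show ?thesis using zero vw by blast
  qed
  ultimately show ?thesis by (auto simp: irreducibles_def)
qed

text \<open>The planar theorem is applied to the vectors that are constant on \<open>B\<close>, constant on \<open>C\<close> and zero
elsewhere. An irreducible planar point is either one of \<open>(D, 0)\<close>, \<open>(0, D)\<close>, or has both coordinates
below \<open>D\<close>. In the latter case it lifts to an irreducible point: the coordinates of a summand are
congruent modulo \<open>D\<close> within a block and lie below \<open>D\<close>, so they are equal. In the former case it is left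
in the part divisible by \<open>D\<close>; this part may then vanish in one block only, but one irreducible point
fewer has been spent. The count includes the coordinates outside the blocks only where \<open>z\<close> does not
vanish there; this is what a preceding subtraction can gain.\<close>

lemma two_blocks_few_multiples:
  assumes z: "z \<in> cone_points"
    and blocks: "B \<noteq> {}" "C \<noteq> {}" "B \<inter> C = {}"
    and const: "\<And>i j. i \<in> B \<Longrightarrow> j \<in> B \<Longrightarrow> d $ i = d $ j"
      "\<And>i j. i \<in> C \<Longrightarrow> j \<in> C \<Longrightarrow> d $ i = d $ j"
    and rest: "\<And>i. i \<notin> B \<union> C \<Longrightarrow> D dvd z $ i"
  shows "few_multiples (irreducibles cone_points) (card {i. i \<in> B \<union> C \<or> z $ i \<noteq> 0}) z"
proof -
  let ?H = "irreducibles cone_points"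
  define N where "N = {i. i \<in> B \<union> C \<or> z $ i \<noteq> 0}"
  define lift :: "int \<times> int \<Rightarrow> int ^ 'n"
    where "lift = (\<lambda>(a, b). \<chi> i. if i \<in> B then a else if i \<in> C then b else 0)"
  define G where "G = {X. lift X \<in> lattice}"
  have lift_nth: "lift (a, b) $ i = (if i \<in> B then a else if i \<in> C then b else 0)" for a b i
    by (simp add: lift_def)
  have lift_diff: "lift (X - Y) = lift X - lift Y" for X Y
    by (cases X; cases Y) (simp add: vec_eq_iff lift_nth)
  have lift_add: "lift (X + Y) = lift X + lift Y" for X Y
    by (cases X; cases Y) (simp add: vec_eq_iff lift_nth)
  have G_diff: "X - Y \<in> G" if "X \<in> G" "Y \<in> G" for X Y
    using that lattice_diff by (simp add: G_def lift_diff)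
  have G_axes: "(D, 0) \<in> G" "(0, D) \<in> G"
    unfolding G_def by (auto intro!: lattice_integral simp: lift_nth)
  have z_lattice: "z \<in> lattice" and z_nonneg: "0 \<le> z $ i" for i
    using z by (auto simp: cone_points_def)
  \<comment> \<open>the minima of \<open>z\<close> on the blocks form the planar point to be represented\<close>
  obtain i0 where i0: "i0 \<in> B" "\<And>i. i \<in> B \<Longrightarrow> z $ i0 \<le> z $ i"
    using ex_min_if_finite[of "(\<lambda>i. z $ i) ` B"] blocks(1) by (auto simp: not_less)
  obtain j0 where j0: "j0 \<in> C" "\<And>i. i \<in> C \<Longrightarrow> z $ j0 \<le> z $ i"
    using ex_min_if_finite[of "(\<lambda>i. z $ i) ` C"] blocks(2) by (auto simp: not_less)
  have ij: "i0 \<noteq> j0" "j0 \<notin> B" "i0 \<in> N" "j0 \<in> N" using i0 j0 blocks by (auto simp: N_def)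
  define x where "x = z - lift (z $ i0, z $ j0)"
  have x_dvd: "D dvd x $ i" for i
    using rest[of i] lattice_cong[OF z_lattice const(1)[of i i0]]
      lattice_cong[OF z_lattice const(2)[of i j0]] i0(1) j0(1)
    by (simp add: x_def lift_nth)
  have x_nonneg: "0 \<le> x $ i" for i
    using z_nonneg i0(2) j0(2) by (auto simp: x_def lift_nth)
  have x_zero: "x $ i0 = 0" "x $ j0 = 0" using i0(1) j0(1) ij by (auto simp: x_def lift_nth)
  have x_outside: "x $ i = 0" if "i \<notin> N" for i using that by (auto simp: x_def lift_nth N_def)
  have "lift (z $ i0, z $ j0) \<in> lattice"
    using lattice_diff[OF z_lattice lattice_integral[OF x_dvd]] by (simp add: x_def)
  then have "(z $ i0, z $ j0) \<in> quadrant_part G"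
    using z_nonneg by (auto simp: quadrant_part_def G_def)
  from planar_two_irreducibles[OF G_diff D_pos G_axes this]
  obtain a b a' b' and s s' :: nat where
    irr: "(a, b) \<in> irreducibles (quadrant_part G)" "(a', b') \<in> irreducibles (quadrant_part G)"
    and P: "z $ i0 = int s * a + int s' * a'" "z $ j0 = int s * b + int s' * b'"
    by blast
  \<comment> \<open>lifts of irreducible planar points other than the two axis points of length \<open>D\<close>\<close>
  have good: "lift (a, b) \<in> ?H"
    if irr: "(a, b) \<in> irreducibles (quadrant_part G)" and less: "a < D" "b < D" for a b
  proof -
    have ab: "0 \<le> a" "0 \<le> b" "lift (a, b) \<in> lattice" "(a, b) \<noteq> 0"
      using irr by (auto simp: irreducibles_def quadrant_part_def G_def)
    have blockwise: "v = lift (v $ i0, v $ j0)"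
      if v: "v \<in> cone_points" "\<And>i. v $ i \<le> lift (a, b) $ i" for v
    proof -
      have nn: "0 \<le> v $ i" for i using v by (auto simp: cone_points_def)
      have lt: "v $ i < D" for i
        using v(2)[of i] less D_pos by (auto simp: lift_nth split: if_splits)
      have eq: "v $ i = v $ j" if "d $ i = d $ j" for i j
      proof (rule cong_imp_eq)
        show "D dvd v $ i - v $ j"
          using v(1) that lattice_cong by (simp add: cone_points_def)
      qed (rule nn lt)+
      have "v $ i = (if i \<in> B then v $ i0 else if i \<in> C then v $ j0 else 0)" for i
        using eq[OF const(1)[of i i0]] eq[OF const(2)[of i j0]] i0(1) j0(1) nn[of i] v(2)[of i]
        by (simp add: lift_nth split: if_splits)
      then show ?thesis unfolding vec_eq_iff lift_nth by blast
    qed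
    have "v = 0 \<or> w = 0" if vw: "v \<in> cone_points" "w \<in> cone_points" "lift (a, b) = v + w" for v w
    proof -
      have nn: "0 \<le> v $ i" "0 \<le> w $ i" for i using vw(1,2) by (auto simp: cone_points_def)
      have v: "v = lift (v $ i0, v $ j0)" using vw nn by (intro blockwise) auto
      have w: "w = lift (w $ i0, w $ j0)" using vw nn by (intro blockwise) auto
      have "(v $ i0, v $ j0) \<in> quadrant_part G" "(w $ i0, w $ j0) \<in> quadrant_part G"
        using nn vw(1,2) v[symmetric] w[symmetric]
        by (simp_all add: quadrant_part_def G_def cone_points_def)
      moreover have "(a, b) = (v $ i0, v $ j0) + (w $ i0, w $ j0)"
        using arg_cong[OF vw(3), of "\<lambda>x. x $ i0"] arg_cong[OF vw(3), of "\<lambda>x. x $ j0"]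
          i0(1) j0(1) ij by (auto simp: lift_nth)
      ultimately have "(v $ i0, v $ j0) = 0 \<or> (w $ i0, w $ j0) = 0"
        using irr unfolding irreducibles_def by blast
      moreover have "lift 0 = 0" by (simp add: zero_prod_def vec_eq_iff lift_nth)
      ultimately show ?thesis using v w by metis
    qed
    moreover have "lift (a, b) \<noteq> 0"
    proof
      assume "lift (a, b) = 0"
      then have "lift (a, b) $ i0 = 0" "lift (a, b) $ j0 = 0" by auto
      then show False using ab(4) i0(1) j0(1) ij by (auto simp: lift_nth zero_prod_def)
    qed
    moreover have "lift (a, b) \<in> cone_points"
      using ab by (auto simp: cone_points_def lift_nth)
    ultimately show ?thesis by (auto simp: irreducibles_def)
  qed
  have bad: "(a, b) = (D, 0) \<or> (a, b) = (0, D)"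
    if irr: "(a, b) \<in> irreducibles (quadrant_part G)" and large: "\<not> (a < D \<and> b < D)" for a b
  proof -
    have ab: "0 \<le> a" "0 \<le> b" "(a, b) \<in> G"
      and dec: "\<And>v w. v \<in> quadrant_part G \<Longrightarrow> w \<in> quadrant_part G \<Longrightarrow> (a, b) = v + w \<Longrightarrow> v = 0 \<or> w = 0"
      using irr unfolding irreducibles_def quadrant_part_def by blast+
    show ?thesis
    proof (cases "a < D")
      case False
      have "(D, 0 :: int) = 0 \<or> (a - D, b) = 0"
        by (intro dec)
          (use False ab D_pos G_axes G_diff[OF ab(3) G_axes(1)] in \<open>auto simp: quadrant_part_def\<close>)
      then show ?thesis using D_pos by (auto simp: zero_prod_def)
    next
      case True
      have "(0 :: int, D) = 0 \<or> (a, b - D) = 0"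
        by (intro dec)
          (use True large ab D_pos G_axes G_diff[OF ab(3) G_axes(2)] in \<open>auto simp: quadrant_part_def\<close>)
      then show ?thesis using D_pos by (auto simp: zero_prod_def)
    qed
  qed
  have decomposition: "z = of_nat s *s lift (a, b) + (of_nat s' *s lift (a', b') + x)"
    using P by (auto simp: x_def vec_eq_iff lift_nth)
  have one_good: "few_multiples ?H (card N) (of_nat s *s lift (a, b) + (of_nat s' *s lift (a', b') + x))"
    if g: "lift (a, b) \<in> ?H" and b: "(a', b') = (D, 0) \<or> (a', b') = (0, D)" for a b a' b' and s s' :: nat
  proof -
    define y where "y = of_nat s' *s lift (a', b') + x"
    obtain k where k: "k \<in> N" "y $ k = 0"
      using b ij x_zero i0(1) j0(1) by (auto simp: y_def lift_nth)
    have "few_multiples ?H (card {i. y $ i \<noteq> 0}) y"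
      using b x_dvd x_nonneg D_pos
      by (intro integral_few_multiples) (auto simp: y_def lift_nth)
    moreover have "y $ i = 0" if "i \<notin> N" for i
      using x_outside[OF that] that by (auto simp: y_def lift_nth N_def)
    then have "{i. y $ i \<noteq> 0} \<subseteq> N - {k}" using k(2) by auto
    then have "card {i. y $ i \<noteq> 0} \<le> card N - 1"
      using k card_mono[of "N - {k}"] by simp
    ultimately have "few_multiples ?H (card N - 1) y" using few_multiples_mono by blast
    from few_multiples_add[OF few_multiples_single[OF g, of s] this]
    show ?thesis using k card_gt_0_iff[of N] by (auto simp: y_def)
  qed
  consider "lift (a, b) \<in> ?H" "lift (a', b') \<in> ?H"
    | "lift (a, b) \<in> ?H" "(a', b') = (D, 0) \<or> (a', b') = (0, D)"
    | "lift (a', b') \<in> ?H" "(a, b) = (D, 0) \<or> (a, b) = (0, D)"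
    | "(a, b) = (D, 0) \<or> (a, b) = (0, D)" "(a', b') = (D, 0) \<or> (a', b') = (0, D)"
    using good bad irr by meson
  then have "few_multiples ?H (card N) z"
  proof cases
    case 1
    have "{i. x $ i \<noteq> 0} \<subseteq> N - {i0, j0}" using x_zero x_outside by auto
    then have "card {i. x $ i \<noteq> 0} \<le> card N - 2"
      using ij card_mono[of "N - {i0, j0}"] by (simp add: card_Diff_subset numeral_2_eq_2)
    then have "few_multiples ?H (card N - 2) x"
      using integral_few_multiples[OF x_nonneg x_dvd] few_multiples_mono by blast
    from few_multiples_add[OF few_multiples_single[OF 1(1), of s]
        few_multiples_add[OF few_multiples_single[OF 1(2), of s'] this]]
    have "few_multiples ?H (1 + (1 + (card N - 2))) z" using decomposition by simp
    moreover have "card {i0, j0} \<le> card N" using ij by (intro card_mono) auto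
    then have "1 + (1 + (card N - 2)) = card N" using ij by simp
    ultimately show ?thesis by simp
  next
    case 2
    then show ?thesis using one_good decomposition by simp
  next
    case 3
    from one_good[OF this, of s' s] show ?thesis by (subst decomposition) (simp add: algebra_simps)
  next
    case 4
    have "D dvd z $ i" for i
      using 4 x_dvd[of i] by (subst decomposition) (auto simp: lift_nth)
    then have "few_multiples ?H (card {i. z $ i \<noteq> 0}) z"
      using z_nonneg by (intro integral_few_multiples)
    moreover have "card {i. z $ i \<noteq> 0} \<le> card N" by (intro card_mono) (auto simp: N_def)
    ultimately show ?thesis using few_multiples_mono by blast
  qed
  then show ?thesis by (simp add: N_def)
qed

text \<open>The multiple subtracted is the least quotient \<open>z\<^sub>i div d\<^sub>i\<close>; as \<open>d\<^sub>i\<close> divides \<open>z\<^sub>i\<close>, nothing is left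
at a coordinate where it is attained.\<close>

lemma exhaust_generator:
  assumes "z \<in> cone_points"
  obtains t z' i where "z = of_nat t *s d + z'" "z' \<in> cone_points" "z' $ i = 0"
proof -
  have nn: "0 \<le> z $ i" and zL: "z \<in> lattice" for i using assms by (auto simp: cone_points_def)
  obtain i where i: "\<And>j. z $ i div d $ i \<le> z $ j div d $ j"
    using ex_min_if_finite[of "range (\<lambda>i. z $ i div d $ i)"] by (auto simp: not_less)
  define t where "t = z $ i div d $ i"
  have t: "0 \<le> t" using nn[of i] d_pos[of i] by (simp add: t_def pos_imp_zdiv_nonneg_iff)
  have dL: "d \<in> lattice" by (auto simp: lattice_def intro!: exI[of _ 1])
  have "t * d $ j \<le> z $ j" for j
  proof -
    have "t * d $ j \<le> (z $ j div d $ j) * d $ j"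
      using i[of j] d_pos[of j] by (auto simp: t_def intro!: mult_right_mono)
    also have "\<dots> = z $ j" using d_dvd_lattice[OF zL] by simp
    finally show ?thesis .
  qed
  then have "z - t *s d \<in> cone_points"
    using lattice_diff[OF zL lattice_scale[OF dL]] by (auto simp: cone_points_def)
  moreover have "(z - t *s d) $ i = 0" using d_dvd_lattice[OF zL, of i] by (simp add: t_def)
  moreover have "z = of_nat (nat t) *s d + (z - t *s d)" using t by simp
  ultimately show ?thesis using that by blast
qed

text \<open>With three classes of coordinates the subtraction of \<open>d\<close> removes one class and one coordinate at the
price of one irreducible point; the entry 1 is what makes \<open>d\<close> irreducible.\<close>

theorem cone_points_few_multiples:
  assumes z: "z \<in> cone_points"
    and few_vals: "card (range (($) d)) \<le> 2 \<or> card (range (($) d)) = 3 \<and> (\<exists>i. d $ i = 1)"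
  shows "few_multiples (irreducibles cone_points) CARD('n) z"
proof -
  let ?H = "irreducibles cone_points"
  have "card (range (($) d)) \<noteq> 0" by simp
  then consider (three) "card (range (($) d)) = 3" | (two) "card (range (($) d)) = 2"
    | (one) "card (range (($) d)) = 1"
    using few_vals by linarith
  then show ?thesis
  proof cases
    case three
    then obtain i1 where "d $ i1 = 1" using few_vals by auto
    then have dH: "d \<in> ?H" by (rule generator_irreducible)
    obtain t z' i where t: "z = of_nat t *s d + z'" "z' \<in> cone_points" "z' $ i = 0"
      using exhaust_generator[OF z] by metis
    \<comment> \<open>on the class of \<open>i\<close> the rest is divisible by \<open>D\<close>, so the other two classes serve as blocks\<close>
    have "card (range (($) d) - {d $ i}) = 2" using three by simp
    then obtain u v where uv: "range (($) d) - {d $ i} = {u, v}" "u \<noteq> v"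
      unfolding card_2_iff by blast
    define B where "B = {j. d $ j = u}"
    define C where "C = {j. d $ j = v}"
    have "few_multiples ?H (card {j. j \<in> B \<union> C \<or> z' $ j \<noteq> 0}) z'"
    proof (rule two_blocks_few_multiples[OF t(2)])
      have "u \<in> range (($) d)" "v \<in> range (($) d)" using uv by auto
      then show "B \<noteq> {}" "C \<noteq> {}" by (auto simp: B_def C_def)
      show "D dvd z' $ j" if "j \<notin> B \<union> C" for j
      proof -
        have "d $ j = d $ i" using uv that by (auto simp: B_def C_def)
        then show ?thesis using lattice_cong[of z' j i] t by (simp add: cone_points_def)
      qed
    qed (use uv in \<open>auto simp: B_def C_def\<close>)
    moreover have "i \<notin> B \<union> C" using uv by (auto simp: B_def C_def)
    then have "{j. j \<in> B \<union> C \<or> z' $ j \<noteq> 0} \<subset> UNIV" using t(3) by blast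
    then have "card {j. j \<in> B \<union> C \<or> z' $ j \<noteq> 0} < CARD('n)" by (intro psubset_card_mono) auto
    ultimately have "few_multiples ?H (CARD('n) - 1) z'" by (elim few_multiples_mono) auto
    from few_multiples_add[OF few_multiples_single[OF dH, of t] this]
    show ?thesis using t(1) by simp
  next
    case two
    then obtain u v where uv: "range (($) d) = {u, v}" "u \<noteq> v"
      unfolding card_2_iff by blast
    define B where "B = {j. d $ j = u}"
    define C where "C = {j. d $ j = v}"
    have BC: "B \<union> C = UNIV" using uv(1) by (auto simp: B_def C_def)
    have "few_multiples ?H (card {j. j \<in> B \<union> C \<or> z $ j \<noteq> 0}) z"
    proof (rule two_blocks_few_multiples[OF z])
      have "u \<in> range (($) d)" "v \<in> range (($) d)" using uv by auto
      then show "B \<noteq> {}" "C \<noteq> {}" by (auto simp: B_def C_def)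
    qed (use uv BC in \<open>auto simp: B_def C_def\<close>)
    then show ?thesis using BC by simp
  next
    case one
    then have eq: "d $ i = d $ j" for i j by (metis card_1_singletonE rangeI singletonD)
    fix i :: 'n
    show ?thesis
    \<comment> \<open>blocks only need constant \<open>d\<close>, so a single class is split in two unless it is a single coordinate\<close>
    proof (cases "UNIV = {i}")
      case True
      then have "z = axis i (z $ i)" by (auto simp: vec_eq_iff axis_def)
      then have "few_multiples ?H 1 z" using axis_few_multiples[of i "z $ i"] z by simp
      moreover have "CARD('n) = 1" using arg_cong[OF True, of card] by simp
      ultimately show ?thesis by simp
    next
      case False
      then have "few_multiples ?H (card {j. j \<in> {i} \<union> - {i} \<or> z $ j \<noteq> 0}) z"
        by (intro two_blocks_few_multiples[OF z] eq) auto
      then show ?thesis by simp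
    qed
  qed
qed

lemma cone_points_add: "x \<in> cone_points \<Longrightarrow> y \<in> cone_points \<Longrightarrow> x + y \<in> cone_points"
  by (simp add: cone_points_def lattice_add)

lemma zero_cone_points: "0 \<in> cone_points"
  by (simp add: cone_points_def lattice_integral)

text \<open>A point with a coordinate above \<open>D\<close> splits off the axis point of length \<open>D\<close>.\<close>

lemma finite_irreducibles: "finite (irreducibles cone_points)"
proof -
  have "v $ i \<le> D" if v: "v \<in> irreducibles cone_points" for v i
  proof (rule ccontr)
    assume less: "\<not> v $ i \<le> D"
    have vL: "v \<in> lattice" and vn: "0 \<le> v $ j" for j
      using v by (auto simp: irreducibles_def cone_points_def)
    have axis: "axis i D \<in> cone_points"
      using D_pos by (auto simp: cone_points_def axis_def intro!: lattice_integral)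
    have "v - axis i D \<in> cone_points"
      using lattice_diff[OF vL, of "axis i D"] axis less vn by (auto simp: cone_points_def axis_def)
    moreover have "v = axis i D + (v - axis i D)" by simp
    ultimately have "axis i D = 0 \<or> v - axis i D = 0"
      using v axis unfolding irreducibles_def by blast
    then have "axis i D $ i = 0 \<or> (v - axis i D) $ i = 0" by auto
    then show False using less D_pos by (auto simp: axis_def)
  qed
  then have "irreducibles cone_points \<subseteq> vec_lambda ` (PiE UNIV (\<lambda>_. {0..D}))"
    by (auto simp: irreducibles_def cone_points_def image_iff intro!: bexI[of _ "($) _"])
  then show ?thesis by (rule finite_subset) (intro finite_imageI finite_PiE, auto)
qed

text \<open>The entries of \<open>d\<close> lie among the at most three divisors of \<open>D\<close> different from \<open>D\<close>; if they exhaust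
three such divisors, they include the divisor 1.\<close>

lemma few_coordinate_values:
  assumes fin: "finite {e :: nat. e dvd nat D}" and card: "card {e :: nat. e dvd nat D} \<le> 4"
  shows "card (range (($) d)) \<le> 2 \<or> card (range (($) d)) = 3 \<and> (\<exists>i. d $ i = 1)"
proof -
  define E where "E = {e :: nat. e dvd nat D} - {nat D}"
  define V where "V = nat ` range (($) d)"
  have "inj_on nat (range (($) d))"
    by (rule inj_onI) (use d_pos in \<open>auto simp: eq_nat_nat_iff less_imp_le\<close>)
  then have card_V: "card V = card (range (($) d))" unfolding V_def by (rule card_image)
  have "nat (d $ i) \<in> E" for i
    using d_dvd[of i] d_pos[of i] d_less[of i] by (auto simp: E_def nat_dvd_iff nat_eq_iff)
  then have V: "V \<subseteq> E" by (auto simp: V_def)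
  have E: "finite E" "card E \<le> 3" using fin card by (auto simp: E_def card_Diff_singleton)
  show ?thesis
  proof (cases "card V \<le> 2")
    case False
    moreover have "card V \<le> card E" using V E by (intro card_mono)
    ultimately have "card V = 3" "card E = 3" using E by auto
    then have "V = E" using V E by (intro card_subset_eq) auto
    moreover have "1 < D" using d_pos[of undefined] d_less[of undefined] by linarith
    then have "1 \<in> E" by (auto simp: E_def)
    ultimately obtain i where "nat (d $ i) = 1" by (force simp: V_def)
    then have "d $ i = 1" by linarith
    then show ?thesis using \<open>card V = 3\<close> card_V by auto
  qed (simp add: card_V)
qed

end

section \<open>Hilbert bases and the integer Caratheodory rank\<close>

text \<open>An irreducible point that is a nonnegative integral combination of a set of points must belong to that set, so
every generating set contains all irreducible points. As these generate, they are the unique minimal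
generating set.\<close>

lemma hilbert_basis_eq_irreducibles:
  fixes C :: "(real ^ 'n) set"
  assumes add: "\<And>x y. x \<in> C \<inter> int_points \<Longrightarrow> y \<in> C \<inter> int_points \<Longrightarrow> x + y \<in> C \<inter> int_points"
    and zero: "0 \<in> C \<inter> int_points"
    and decompose: "\<And>z. z \<in> C \<inter> int_points \<Longrightarrow> \<exists>k. few_multiples (irreducibles (C \<inter> int_points)) k z"
  shows "hilbert_basis C = irreducibles (C \<inter> int_points)"
proof -
  define M where "M = C \<inter> int_points"
  let ?I = "irreducibles M"
  have multiple: "real c *\<^sub>R x \<in> M" if "x \<in> M" for c x
    using that zero add unfolding M_def by (induction c) (auto simp: scaleR_left_distrib)
  have sum_mem: "(\<Sum>h\<in>F. real (c h) *\<^sub>R h) \<in> M" if "finite F" "F \<subseteq> M" for F c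
    using that by (induction F rule: finite_induct) (use zero add multiple in \<open>auto simp: M_def\<close>)
  have generates: "generates_int_points ?I C"
  proof -
    have "z \<in> nat_combinations ?I" if z: "z \<in> M" for z
    proof -
      obtain k where "few_multiples ?I k z" using decompose[of z] z by (auto simp: M_def)
      then obtain S c where "finite S" "S \<subseteq> ?I" "z = (\<Sum>h\<in>S. of_nat (c h) *s h)"
        by (auto simp: few_multiples_def)
      then show ?thesis unfolding nat_combinations_def by (auto simp: scalar_mult_eq_scaleR)
    qed
    then show ?thesis by (auto simp: generates_int_points_def M_def irreducibles_def)
  qed
  have necessary: "?I \<subseteq> H" if H: "generates_int_points H C" for H
  proof
    fix h assume h: "h \<in> ?I"
    then have hM: "h \<in> M" "h \<noteq> 0" by (auto simp: irreducibles_def)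
    then obtain F c where F: "finite F" "F \<subseteq> H" "h = (\<Sum>x\<in>F. real (c x) *\<^sub>R x)"
      using H by (auto simp: generates_int_points_def nat_combinations_def M_def)
    have FM: "F \<subseteq> M" using F H by (auto simp: generates_int_points_def M_def)
    obtain x where x: "x \<in> F" "real (c x) *\<^sub>R x \<noteq> 0"
      using F(3) hM(2) sum.neutral[of F "\<lambda>x. real (c x) *\<^sub>R x"] by blast
    define rest where "rest = real (c x - 1) *\<^sub>R x + (\<Sum>y\<in>F - {x}. real (c y) *\<^sub>R y)"
    have "h = real (c x) *\<^sub>R x + (\<Sum>y\<in>F - {x}. real (c y) *\<^sub>R y)"
      using F x by (simp add: sum.remove)
    also have "real (c x) *\<^sub>R x = x + real (c x - 1) *\<^sub>R x"
      using x by (cases "c x") (auto simp: scaleR_left_distrib)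
    finally have "h = x + rest" by (simp add: rest_def)
    moreover have "rest \<in> M"
      using add multiple[of x] sum_mem[of "F - {x}" c] FM F x unfolding rest_def M_def by blast
    ultimately have "rest = 0" using h FM x unfolding irreducibles_def by auto
    then show "h \<in> H" using \<open>h = x + rest\<close> F x by auto
  qed
  show ?thesis unfolding hilbert_basis_def M_def[symmetric]
    by (rule the_equality) (use generates necessary in blast)+
qed

lemma icr_le:
  fixes C :: "(real ^ 'n) set"
  assumes "\<And>z. z \<in> C \<inter> int_points \<Longrightarrow> few_multiples (hilbert_basis C) k z"
  shows "icr C \<le> enat k"
  unfolding icr_def
proof (rule SUP_least)
  fix z assume "z \<in> C \<inter> int_points"
  then obtain S c where S: "finite S" "S \<subseteq> hilbert_basis C" "card S \<le> k"
      "z = (\<Sum>h\<in>S. of_nat (c h) *s h)"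
    using assms[of z] unfolding few_multiples_def by blast
  obtain h where h: "bij_betw h {1..card S} S" using ex_bij_betw_nat_finite_1[OF S(1)] by blast
  have "z = (\<Sum>i = 1..card S. real (c (h i)) *\<^sub>R h i)"
    unfolding S(4) sum.reindex_bij_betw[OF h, symmetric] by (simp add: scalar_mult_eq_scaleR)
  moreover have "\<forall>i\<in>{1..card S}. h i \<in> hilbert_basis C"
    using S(2) h by (auto simp: bij_betw_def)
  ultimately have "card S \<in> {k. \<exists>(l :: nat \<Rightarrow> nat) h. (\<forall>i\<in>{1..k}. h i \<in> hilbert_basis C) \<and>
      z = (\<Sum>i = 1..k. real (l i) *\<^sub>R h i)}"
    by (intro CollectI exI[of _ "\<lambda>i. c (h i)"] exI[of _ h]) blast
  then show "(INF k\<in>{k. \<exists>(l :: nat \<Rightarrow> nat) h. (\<forall>i\<in>{1..k}. h i \<in> hilbert_basis C) \<and>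
      z = (\<Sum>i = 1..k. real (l i) *\<^sub>R h i)}. enat k) \<le> enat k"
    by (rule INF_lower2) (use S(3) in simp)
qed

text \<open>Along the curve the inner product is a nonzero polynomial in \<open>t\<close>.\<close>

lemma finite_moment_curve_hits:
  fixes a :: "real ^ 'n"
  assumes e: "bij_betw e (UNIV :: 'n set) {..<CARD('n)}" and a: "a \<noteq> 0"
  shows "finite {t::nat. a \<bullet> (\<chi> i. real t ^ e i) = 0}"
proof -
  define e' where "e' = inv_into UNIV e"
  have e': "bij_betw e' {..<CARD('n)} UNIV" "\<And>m. m < CARD('n) \<Longrightarrow> e (e' m) = m"
    using bij_betw_inv_into[OF e] bij_betw_inv_into_right[OF e] by (auto simp: e'_def)
  define c where "c m = (if m < CARD('n) then a $ e' m else 0)" for m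
  have "a \<bullet> (\<chi> i. t ^ e i) = (\<Sum>m\<le>CARD('n). c m * t ^ m)" for t
  proof -
    have "a \<bullet> (\<chi> i. t ^ e i) = (\<Sum>i\<in>UNIV. a $ i * t ^ e i)"
      by (simp add: inner_vec_def)
    also have "\<dots> = (\<Sum>m<CARD('n). a $ e' m * t ^ e (e' m))"
      by (rule sum.reindex_bij_betw[OF e'(1), symmetric])
    also have "\<dots> = (\<Sum>m\<le>CARD('n). c m * t ^ m)"
      by (rule sum.mono_neutral_cong_left) (auto simp: c_def e'(2))
    finally show ?thesis .
  qed
  moreover obtain i where i: "a $ i \<noteq> 0" using a by (auto simp: vec_eq_iff)
  have "e i < CARD('n)" "e' (e i) = i"
    using e by (auto simp: bij_betw_def e'_def)
  then have "\<exists>m\<le>CARD('n). c m \<noteq> 0" using i by (intro exI[of _ "e i"]) (simp add: c_def)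
  then have "finite {t. (\<Sum>m\<le>CARD('n). c m * t ^ m) = 0}" by (simp add: polyfun_finite_roots)
  from finite_vimageI[OF this inj_of_nat]
  have "finite {t::nat. (\<Sum>m\<le>CARD('n). c m * real t ^ m) = 0}" by (simp add: vimage_def)
  ultimately show ?thesis by simp
qed

section \<open>Cones spanned by integer matrices\<close>

lemma pos_eq_image: "pos A = (*v) A ` {l. \<forall>i. 0 \<le> l $ i}"
proof -
  have "(\<Sum>i\<in>UNIV. l i *\<^sub>R column i A) = A *v (\<chi> i. l i)" for l
    by (simp add: matrix_mult_sum scalar_mult_eq_scaleR)
  then have "pos A = {A *v (\<chi> i. l i) |l. \<forall>i. 0 \<le> l i}" unfolding pos_def by auto
  also have "\<dots> = (*v) A ` {l. \<forall>i. 0 \<le> l $ i}"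
  proof (intro equalityI subsetI)
    fix x assume "x \<in> (*v) A ` {l. \<forall>i. 0 \<le> l $ i}"
    then obtain l where "x = A *v (\<chi> i. l $ i)" "\<forall>i. 0 \<le> l $ i" by auto
    then show "x \<in> {A *v (\<chi> i. l i) |l. \<forall>i. 0 \<le> l i}" by blast
  qed auto
  finally show ?thesis .
qed

lemma interior_orthant: "interior {l :: real ^ 'n. \<forall>i. 0 \<le> l $ i} = {l. \<forall>i. 0 < l $ i}"
proof (rule interior_unique)
  have "{l :: real ^ 'n. \<forall>i. 0 < l $ i} = (\<Inter>i. {l. 0 < l $ i})" by auto
  also have "open \<dots>" by (intro open_INT ballI open_Collect_less continuous_intros) simp
  finally show "open {l :: real ^ 'n. \<forall>i. 0 < l $ i}" .
next
  fix T :: "(real ^ 'n) set" assume T: "T \<subseteq> {l. \<forall>i. 0 \<le> l $ i}" "open T"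
  show "T \<subseteq> {l. \<forall>i. 0 < l $ i}"
  proof
    fix x assume "x \<in> T"
    then obtain e where e: "0 < e" "ball x e \<subseteq> T" using T(2) open_contains_ball by blast
    have "0 < x $ i" for i
    proof -
      have "x - axis i (e / 2) \<in> ball x e"
      proof -
        have "axis i (e / 2) = (e / 2) *\<^sub>R (axis i 1 :: real ^ 'n)"
          by (simp add: vec_eq_iff axis_def)
        then show ?thesis using e by (simp add: dist_norm)
      qed
      then have "0 \<le> (x - axis i (e / 2)) $ i" using e T(1) by blast
      then show ?thesis using e by simp
    qed
    then show "x \<in> {l. \<forall>i. 0 < l $ i}" by simp
  qed
qed (auto intro: less_imp_le)

lemma interior_pos:
  fixes A :: "real ^ 'n ^ 'n"
  assumes "invertible A"
  shows "interior (pos A) = (*v) A ` {l. \<forall>i. 0 < l $ i}"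
proof -
  have "inj ((*v) A)" using assms by (rule inj_matrix_vector_mult)
  from interior_injective_linear_image[OF matrix_vector_mul_linear this] show ?thesis
    by (simp only: pos_eq_image interior_orthant)
qed

lemma det_real_mat: "det (real_mat R) = of_int (det R)"
proof -
  have "(\<Prod>i\<in>UNIV. real_mat R $ i $ p i) = of_int (\<Prod>i\<in>UNIV. R $ i $ p i)" for p
    by (simp add: map_matrix_def)
  then show ?thesis unfolding det_def by (simp only: of_int_sum of_int_mult of_int_eq_id id_apply)
qed

lemma int_points_matrix_image:
  assumes "\<And>i. x $ i \<in> \<int>" shows "real_mat R *v x \<in> int_points"
  using assms by (auto simp: int_points_def matrix_vector_mult_def map_matrix_def)

text \<open>A set of fewer than \<open>n\<close> elements of the Hilbert basis spans a proper subspace, which lies in a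
hyperplane and so contains only finitely many points of the moment curve. There are finitely many such
sets, so some point of the curve lies in none of their spans.\<close>

lemma icr_ge_dimension:
  fixes R :: "int ^ 'n ^ 'n"
  assumes det: "det R \<noteq> 0" and fin: "finite (hilbert_basis (pos (real_mat R)))"
  shows "enat CARD('n) \<le> icr (pos (real_mat R))"
proof -
  define A where "A = real_mat R"
  define H where "H = hilbert_basis (pos A)"
  obtain e where e: "bij_betw e (UNIV :: 'n set) {..<CARD('n)}"
    using ex_bij_betw_finite_nat[of "UNIV :: 'n set"] by (auto simp: atLeast0LessThan)
  define z where "z t = A *v (\<chi> i. real t ^ e i)" for t :: nat
  have inv: "invertible A" using det by (simp add: A_def invertible_det_nz det_real_mat)
  have hits: "finite {t. z t \<in> span S}" if S: "S \<subseteq> H" "card S < CARD('n)" for S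
  proof -
    have "finite S" using S(1) fin finite_subset by (auto simp: H_def A_def)
    then have "dim (span S) < DIM(real ^ 'n)" using S dim_le_card'[of S] by simp
    then obtain a where a: "a \<noteq> 0" "\<And>y. y \<in> span (span S) \<Longrightarrow> orthogonal a y"
      using orthogonal_to_subspace_exists by metis
    define b where "b = a v* A"
    have b: "b \<bullet> x = a \<bullet> (A *v x)" for x by (simp add: b_def dot_lmul_matrix)
    obtain A' where "A ** A' = mat 1" using inv by (auto simp: invertible_def)
    then have "A *v (A' *v a) = a" by (simp add: matrix_vector_mul_assoc)
    then have "b \<bullet> (A' *v a) = a \<bullet> a" by (simp add: b)
    then have "b \<noteq> 0" using a(1) by auto
    from finite_moment_curve_hits[OF e this]
    have fin_b: "finite {t::nat. b \<bullet> (\<chi> i. real t ^ e i) = 0}" .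
    have "a \<bullet> z t = b \<bullet> (\<chi> i. real t ^ e i)" for t
      by (simp add: z_def b)
    moreover have "a \<bullet> z t = 0" if "z t \<in> span S" for t
      using a(2)[of "z t"] that by (simp add: orthogonal_def span_span)
    ultimately have "{t. z t \<in> span S} \<subseteq> {t. b \<bullet> (\<chi> i. real t ^ e i) = 0}"
      by force
    then show ?thesis using fin_b finite_subset by blast
  qed
  have "finite {S. S \<subseteq> H \<and> card S < CARD('n)}" using fin by (simp add: H_def A_def)
  then have "finite (\<Union>S\<in>{S. S \<subseteq> H \<and> card S < CARD('n)}. {t. z t \<in> span S})"
    using hits by blast
  from ex_new_if_finite[OF infinite_UNIV_nat this]
  obtain t where "t \<notin> (\<Union>S\<in>{S. S \<subseteq> H \<and> card S < CARD('n)}. {t. z t \<in> span S})" ..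
  then have t: "z t \<notin> span S" if "S \<subseteq> H" "card S < CARD('n)" for S
    using that by simp
  have "z t \<in> pos A \<inter> int_points"
    unfolding z_def A_def pos_eq_image by (auto intro!: int_points_matrix_image)
  then show ?thesis unfolding icr_def A_def[symmetric] H_def[symmetric]
  proof (rule SUP_upper2, intro INF_greatest)
    fix k assume "k \<in> {k. \<exists>(l :: nat \<Rightarrow> nat) h. (\<forall>i\<in>{1..k}. h i \<in> H) \<and> z t = (\<Sum>i = 1..k. real (l i) *\<^sub>R h i)}"
    then obtain l :: "nat \<Rightarrow> nat" and h where lh: "h ` {1..k} \<subseteq> H" "z t = (\<Sum>i = 1..k. real (l i) *\<^sub>R h i)"
      by auto
    have "z t \<in> span (h ` {1..k})"
      unfolding lh(2) by (intro span_sum span_scale span_base) auto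
    then have "CARD('n) \<le> card (h ` {1..k})" using t lh(1) not_less by blast
    also have "\<dots> \<le> k" using card_image_le[of "{1..k}" h] by simp
    finally show "enat CARD('n) \<le> enat k" by simp
  qed
qed

lemma lattice_quotient_cyclic_generator:
  fixes R :: "int ^ 'n ^ 'n"
  assumes "cyclic_group (lattice_quotient R)"
  obtains g where "\<And>z. \<exists>k w. z = k *s g + R *v w"
proof -
  let ?G = "int_vec_group :: (int ^ 'n) monoid"
  let ?H = "range (\<lambda>z. R *v z)"
  have simps: "carrier ?G = UNIV" "mult ?G = (+)" "one ?G = 0" by (auto simp: int_vec_group_def)
  interpret comm_group ?G
    by (rule comm_groupI) (auto simp: simps algebra_simps intro!: exI[of _ "- _"])
  have inv: "inv\<^bsub>?G\<^esub> x = - x" for x by (rule inv_equality) (auto simp: simps)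
  have "subgroup ?H ?G"
  proof
    fix x y assume "x \<in> ?H" "y \<in> ?H"
    then obtain u v where "x = R *v u" "y = R *v v" by auto
    then show "x \<otimes>\<^bsub>?G\<^esub> y \<in> ?H"
      by (auto simp: simps matrix_vector_right_distrib[symmetric])
  next
    show "\<one>\<^bsub>?G\<^esub> \<in> ?H" by (auto simp: simps intro!: image_eqI[of _ _ 0])
  next
    fix x assume "x \<in> ?H"
    then obtain u where "x = R *v u" by auto
    then have "- x = R *v (- u)"
      by (simp add: matrix_vector_mult_def vec_eq_iff sum_negf)
    then show "inv\<^bsub>?G\<^esub> x \<in> ?H" by (auto simp: inv)
  qed (auto simp: simps)
  then interpret normal ?H ?G by (rule subgroup_imp_normal)
  have nat_pow: "x [^]\<^bsub>?G\<^esub> (k::nat) = of_nat k *s x" for x k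
    by (induction k) (auto simp: simps vector_sadd_rdistrib add.commute)
  have int_pow: "x [^]\<^bsub>?G\<^esub> (k::int) = k *s x" for x k
    by (cases k rule: int_cases2) (auto simp: int_pow_int int_pow_neg_int inv nat_pow simps vec_eq_iff)
  interpret Q: group "lattice_quotient R"
    unfolding lattice_quotient_def by (rule factorgroup_is_group)
  obtain X where X: "X \<in> carrier (lattice_quotient R)"
      "carrier (lattice_quotient R) = range (\<lambda>k::int. X [^]\<^bsub>lattice_quotient R\<^esub> k)"
    using assms Q.cyclic_group by blast
  obtain g where g: "X = ?H #>\<^bsub>?G\<^esub> g"
    using X(1) by (auto simp: lattice_quotient_def FactGroup_def RCOSETS_def)
  have "\<exists>k w. z = k *s g + R *v w" for z
  proof -
    have "?H #>\<^bsub>?G\<^esub> z \<in> carrier (lattice_quotient R)"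
      by (auto simp: lattice_quotient_def FactGroup_def RCOSETS_def simps)
    then obtain k where "?H #>\<^bsub>?G\<^esub> z = X [^]\<^bsub>lattice_quotient R\<^esub> (k::int)" using X(2) by auto
    also have "\<dots> = ?H #>\<^bsub>?G\<^esub> (k *s g)"
      unfolding g lattice_quotient_def by (subst FactGroup_int_pow) (auto simp: simps int_pow)
    finally have "?H #>\<^bsub>?G\<^esub> z = ?H #>\<^bsub>?G\<^esub> (k *s g)" .
    moreover have "z \<in> ?H #>\<^bsub>?G\<^esub> z"
      using \<open>subgroup ?H ?G\<close> by (intro rcos_self) (auto simp: simps)
    ultimately obtain w where "z = R *v w + k *s g" by (auto simp: r_coset_def simps)
    then have "z = k *s g + R *v w" by (simp only: add.commute)
    then show ?thesis by blast
  qed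
  then show ?thesis using that by blast
qed

text \<open>Let \<open>N\<close> be the order of \<open>g\<close> modulo \<open>D\<close> and \<open>c = gcd k N\<close>. Then \<open>N / c\<close> annihilates \<open>d\<close>, which is
congruent to \<open>k g\<close>. Since \<open>d\<^sub>i\<close> divides \<open>g\<^sub>i\<close>, it annihilates \<open>g\<close> as well, so \<open>c = 1\<close> and \<open>k\<close> is
invertible modulo \<open>N\<close>.\<close>

lemma divisor_generates_cyclic:
  fixes g d :: "int ^ 'n"
  assumes D: "0 < D" and d: "\<And>i. D dvd d $ i - k * g $ i" and dvd: "\<And>i. d $ i dvd g $ i"
  obtains j where "\<And>i. D dvd g $ i - j * d $ i"
proof -
  define N where "N = (LEAST N::nat. 0 < N \<and> (\<forall>i. D dvd int N * g $ i))"
  have ex: "0 < nat D \<and> (\<forall>i. D dvd int (nat D) * g $ i)" using D by auto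
  have N: "0 < N" "\<And>i. D dvd int N * g $ i"
    using LeastI[of "\<lambda>N::nat. 0 < N \<and> (\<forall>i. D dvd int N * g $ i)", OF ex] by (auto simp: N_def)
  have order: "int N dvd m" if m: "\<And>i. D dvd m * g $ i" for m
  proof -
    have "D dvd (m mod int N) * g $ i" for i
    proof -
      have "(m mod int N) * g $ i = m * g $ i - (m div int N) * (int N * g $ i)"
        by (simp add: minus_div_mult_eq_mod[symmetric] algebra_simps)
      then show ?thesis using m N(2) by (metis dvd_diff dvd_mult)
    qed
    then have "\<not> 0 < nat (m mod int N)"
      using not_less_Least[of "nat (m mod int N)" "\<lambda>N::nat. 0 < N \<and> (\<forall>i. D dvd int N * g $ i)"] N(1)
      by (auto simp: N_def[symmetric] nat_less_iff)
    moreover have "0 \<le> m mod int N" using N(1) by simp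
    ultimately have "m mod int N = 0" by simp
    then show ?thesis by (rule mod_0_imp_dvd)
  qed
  define c where "c = gcd k (int N)"
  obtain k' N' where kN: "k = c * k'" "int N = c * N'" using c_def by (metis dvdE gcd_dvd1 gcd_dvd2)
  have "c > 0" using N(1) by (simp add: c_def)
  then have "N' > 0" using N(1) kN(2) by (metis of_nat_0_less_iff zero_less_mult_pos)
  have "D dvd N' * g $ i" for i
  proof -
    have "N' * d $ i = N' * (d $ i - k * g $ i) + k' * (int N * g $ i)"
      by (simp add: kN algebra_simps)
    then have "D dvd N' * d $ i" using d N(2) by (metis dvd_add dvd_mult)
    then show ?thesis using dvd[of i] by (metis dvd_trans mult_dvd_mono dvd_refl)
  qed
  then have "int N dvd N'" by (rule order)
  then have "int N \<le> N'" using \<open>N' > 0\<close> zdvd_imp_le by blast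
  then have "c * N' \<le> 1 * N'" using kN by simp
  then have "c = 1" using \<open>c > 0\<close> \<open>N' > 0\<close> by (simp add: mult_le_cancel_right)
  then obtain u v where uv: "u * k + v * int N = 1" using bezout_int[of k "int N"] by (auto simp: c_def)
  have "D dvd g $ i - u * d $ i" for i
  proof -
    have "g $ i = (u * k + v * int N) * g $ i" using uv by simp
    then have "g $ i - u * d $ i = v * (int N * g $ i) - u * (d $ i - k * g $ i)"
      by (simp add: algebra_simps)
    then show ?thesis using d N(2) by (metis dvd_diff dvd_mult)
  qed
  then show ?thesis using that by blast
qed

text \<open>Scaling by \<open>D\<close> lets integer vectors describe points whose coordinates with respect to the columns of
\<open>A\<close> are multiples of \<open>1 / D\<close>.\<close>

definition of_scaled_coordinates :: "int \<Rightarrow> real ^ 'n ^ 'm \<Rightarrow> int ^ 'n \<Rightarrow> real ^ 'm" where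
  "of_scaled_coordinates D A v = A *v (\<chi> i. real_of_int (v $ i) / of_int D)"

lemma of_scaled_coordinates_add:
  "of_scaled_coordinates D A (u + v) =
     of_scaled_coordinates D A u + of_scaled_coordinates D A v"
proof -
  have "(\<chi> i. real_of_int ((u + v) $ i) / of_int D) =
      (\<chi> i. real_of_int (u $ i) / of_int D) + (\<chi> i. real_of_int (v $ i) / of_int D)"
    by (simp add: vec_eq_iff add_divide_distrib)
  then show ?thesis by (simp add: of_scaled_coordinates_def matrix_vector_right_distrib)
qed

lemma of_scaled_coordinates_scale:
  "of_scaled_coordinates D A (k *s v) = of_int k *\<^sub>R of_scaled_coordinates D A v"
proof -
  have "(\<chi> i. real_of_int ((k *s v) $ i) / of_int D) =
      of_int k *\<^sub>R (\<chi> i. real_of_int (v $ i) / of_int D)"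
    by (simp add: vec_eq_iff)
  then show ?thesis
    by (simp add: of_scaled_coordinates_def matrix_vector_mult_scaleR)
qed

lemma inj_of_scaled_coordinates:
  fixes A :: "real ^ 'n ^ 'n"
  assumes "invertible A" "D \<noteq> 0"
  shows "inj (of_scaled_coordinates D A)"
proof (rule injI)
  fix u v assume "of_scaled_coordinates D A u = of_scaled_coordinates D A v"
  then have "A *v (\<chi> i. real_of_int (u $ i) / of_int D) = A *v (\<chi> i. real_of_int (v $ i) / of_int D)"
    by (simp only: of_scaled_coordinates_def)
  then have "(\<chi> i. real_of_int (u $ i) / of_int D) = (\<chi> i. real_of_int (v $ i) / of_int D)"
    by (rule injD[OF inj_matrix_vector_mult[OF assms(1)]])
  then show "u = v" using assms(2) by (simp add: vec_eq_iff)
qed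

text \<open>By Cramer's rule the coordinates of an integer point with respect to the columns are quotients
of integer determinants by \<open>det R\<close>.\<close>

lemma int_points_scaled_coordinates:
  fixes R :: "int ^ 'n ^ 'n"
  assumes det: "det R \<noteq> 0" and x: "x \<in> int_points"
  obtains v where "x = of_scaled_coordinates \<bar>det R\<bar> (real_mat R) v"
proof -
  define w where "w = (\<chi> i. \<lfloor>x $ i\<rfloor>)"
  have w: "x $ i = of_int (w $ i)" for i
    using x by (auto simp: w_def int_points_def elim!: Ints_cases)
  have inv: "det (real_mat R) \<noteq> 0" using det by (simp add: det_real_mat)
  define minor where "minor k = det (\<chi> i j. if j = k then w $ i else R $ i $ j)" for k
  define v where "v = (\<chi> k. minor k * sgn (det R))"
  have "(\<chi> i j. if j = k then x $ i else real_mat R $ i $ j) =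
      real_mat (\<chi> i j. if j = k then w $ i else R $ i $ j)" for k
    by (simp add: vec_eq_iff map_matrix_def w)
  then have minor: "det (\<chi> i j. if j = k then x $ i else real_mat R $ i $ j) = of_int (minor k)" for k
    by (simp only: det_real_mat minor_def)
  have "real_of_int m / of_int (det R) = of_int (m * sgn (det R)) / of_int \<bar>det R\<bar>" for m
    using det by (cases "0 < det R") (auto simp: sgn_if)
  then have "(\<chi> k. det (\<chi> i j. if j = k then x $ i else real_mat R $ i $ j) / det (real_mat R)) =
      (\<chi> k. of_int (v $ k) / of_int \<bar>det R\<bar>)"
    by (simp add: minor det_real_mat v_def)
  then have "real_mat R *v (\<chi> k. of_int (v $ k) / of_int \<bar>det R\<bar>) = x"
    unfolding cramer[OF inv] by (rule sym)
  then show ?thesis using that[of v] by (simp add: of_scaled_coordinates_def)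
qed

text \<open>This is where the hypotheses on \<open>y\<close> and on the quotient group enter. If \<open>d\<^sub>i\<close> did not divide the
\<open>i\<close>-th coordinate of a lattice point \<open>v\<close>, subtracting a multiple of \<open>d\<close> would leave a positive
remainder below \<open>d\<^sub>i\<close> there, and adding a large vector of \<open>D \<int>\<^sup>n\<close> would make the other coordinates
positive: an interior lattice point that is not above \<open>d\<close>.\<close>

lemma interior_shift_coordinates:
  fixes R :: "int ^ 'n ^ 'n"
  assumes det: "det R \<noteq> 0"
    and y: "y \<in> interior (pos (real_mat R)) \<inter> par (real_mat R)"
    and shift: "(+) y ` (pos (real_mat R) \<inter> int_points) = interior (pos (real_mat R)) \<inter> int_points"
    and cyclic: "cyclic_group (lattice_quotient R)"
  obtains d where "diagonal_lattice \<bar>det R\<bar> d"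
    and "pos (real_mat R) \<inter> int_points =
      of_scaled_coordinates \<bar>det R\<bar> (real_mat R) ` diagonal_lattice.cone_points \<bar>det R\<bar> d"
proof -
  define A where "A = real_mat R"
  define D where "D = \<bar>det R\<bar>"
  define f where "f = of_scaled_coordinates D A"
  have D: "0 < D" using det by (simp add: D_def)
  have inv: "invertible A" using det by (simp add: A_def invertible_det_nz det_real_mat)
  have A_eq: "A *v u = A *v v \<longleftrightarrow> u = v" for u v
    using inj_matrix_vector_mult[OF inv] by (simp add: inj_eq)
  have f_add: "f (u + v) = f u + f v" and f_scale: "f (k *s v) = of_int k *\<^sub>R f v" for u v k
    by (simp_all add: f_def of_scaled_coordinates_add of_scaled_coordinates_scale)
  have f_eq: "f u = f v \<longleftrightarrow> u = v" for u v
    using inj_of_scaled_coordinates[OF inv, of D] D by (simp add: f_def inj_eq)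
  have f_diff: "f (u - v) = f u - f v" for u v using f_add[of "u - v" v] by simp
  have coords: "\<exists>v. x = f v" if "x \<in> int_points" for x
    using int_points_scaled_coordinates[OF det that] by (auto simp: f_def A_def D_def)
  have f_pos: "f v \<in> pos A \<longleftrightarrow> (\<forall>i. 0 \<le> v $ i)" for v
    using D by (auto simp: pos_eq_image f_def of_scaled_coordinates_def image_iff A_eq
        zero_le_divide_iff)
  have f_int: "f v \<in> interior (pos A) \<longleftrightarrow> (\<forall>i. 0 < v $ i)" for v
    using D by (auto simp: interior_pos[OF inv] f_def of_scaled_coordinates_def image_iff A_eq
        zero_less_divide_iff)
  define L where "L = {v. f v \<in> int_points}"
  have L_add: "u + v \<in> L" and L_diff: "u - v \<in> L" if "u \<in> L" "v \<in> L" for u v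
    using that by (auto simp: L_def f_add f_diff int_points_def)
  have L_scale: "k *s u \<in> L" if "u \<in> L" for u k
    using that by (auto simp: L_def f_scale int_points_def)
  have f_integral: "f (D *s w) = A *v (\<chi> i. of_int (w $ i))" for w
    using D by (simp add: f_def of_scaled_coordinates_def)
  have L_integral: "D *s w \<in> L" for w
    unfolding L_def mem_Collect_eq f_integral A_def by (intro int_points_matrix_image) simp
  have "y \<in> int_points" using y by (simp add: par_def)
  then obtain d where d: "y = f d" "d \<in> L" using coords by (auto simp: L_def)
  have d_pos: "0 < d $ i" for i using y f_int by (auto simp: d(1) A_def)
  obtain l where l: "\<And>i. l i \<in> {0..<1}" "y = (\<Sum>i\<in>UNIV. l i *\<^sub>R column i A)"
    using y by (auto simp: par_def A_def)
  have "A *v (\<chi> i. of_int (d $ i) / of_int D) = A *v (\<chi> i. l i)"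
    using d(1) l(2) by (simp add: f_def of_scaled_coordinates_def matrix_mult_sum scalar_mult_eq_scaleR)
  then have "(\<chi> i. of_int (d $ i) / of_int D) = (\<chi> i. l i)" by (simp only: A_eq)
  then have "of_int (d $ i) / of_int D = l i" for i by (simp add: vec_eq_iff)
  then have "of_int (d $ i) / of_int D < (1 :: real)" for i using l(1)[of i] by simp
  then have d_less: "d $ i < D" for i using D by (simp add: divide_less_eq)
  \<comment> \<open>the shift hypothesis: an interior lattice point is \<open>d\<close> plus a point of the orthant\<close>
  have least: "d $ i \<le> v $ i" if v: "v \<in> L" "\<And>j. 0 < v $ j" for v i
  proof -
    have "f v \<in> interior (pos A) \<inter> int_points" using v f_int by (simp add: L_def)
    then obtain c where c: "f v = y + c" "c \<in> pos A" "c \<in> int_points"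
      using shift by (auto simp: A_def)
    then obtain u where u: "c = f u" using coords by blast
    then have "v = d + u" using c d f_eq f_add by metis
    then show ?thesis using c(2) u f_pos by simp
  qed
  have d_dvd_L: "d $ i dvd v $ i" if v: "v \<in> L" for v i
  proof (rule ccontr)
    assume "\<not> d $ i dvd v $ i"
    then have "v $ i mod d $ i \<noteq> 0" by (simp add: dvd_eq_mod_eq_0)
    moreover have "0 \<le> v $ i mod d $ i" using d_pos[of i] by simp
    ultimately have r: "0 < v $ i mod d $ i" by linarith
    define u where "u = v - (v $ i div d $ i) *s d"
    define w where "w = (\<chi> j. if j = i then 0 else \<bar>u $ j\<bar> + 1)"
    have ui: "u $ i = v $ i mod d $ i" by (simp add: u_def minus_div_mult_eq_mod)
    have "u + D *s w \<in> L"
      unfolding u_def by (rule L_add[OF L_diff[OF v L_scale[OF d(2)]] L_integral])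
    moreover have "0 < (u + D *s w) $ j" for j
    proof (cases "j = i")
      case False
      have "0 < u $ j + 1 * (\<bar>u $ j\<bar> + 1)" by simp
      also have "\<dots> \<le> u $ j + D * (\<bar>u $ j\<bar> + 1)"
        using D by (intro add_left_mono mult_right_mono) auto
      finally show ?thesis using False by (simp add: w_def)
    qed (use r ui in \<open>simp add: w_def\<close>)
    ultimately have "d $ i \<le> (u + D *s w) $ i" by (rule least)
    then show False using ui pos_mod_bound[OF d_pos, of "v $ i" i] by (simp add: w_def)
  qed
  have "d $ i dvd (D *s 1) $ i" for i using d_dvd_L[OF L_integral] by blast
  then have "d $ i dvd D" for i by simp
  then interpret diagonal_lattice D d using d_pos d_less by unfold_locales
  obtain g0 where g0: "\<And>z. \<exists>k w. z = k *s g0 + R *v w"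
    using lattice_quotient_cyclic_generator[OF cyclic] by blast
  have "(\<chi> i. of_int (g0 $ i)) \<in> int_points" by (simp add: int_points_def)
  then obtain g where g: "f g = (\<chi> i. of_int (g0 $ i))" using coords by metis
  then have gL: "g \<in> L" by (simp add: L_def int_points_def)
  have L_g: "\<exists>k. \<forall>i. D dvd v $ i - k * g $ i" if v: "v \<in> L" for v
  proof -
    define z where "z = (\<chi> i. \<lfloor>f v $ i\<rfloor>)"
    have z: "f v = (\<chi> i. of_int (z $ i))"
      using v by (auto simp: z_def L_def int_points_def vec_eq_iff elim!: Ints_cases)
    obtain k w where kw: "z = k *s g0 + R *v w" using g0 by blast
    have "f v = of_int k *\<^sub>R f g + f (D *s w)"
      unfolding z g f_integral kw
      by (simp add: vec_eq_iff A_def matrix_vector_mult_def map_matrix_def)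
    also have "\<dots> = f (k *s g + D *s w)" by (simp add: f_add f_scale)
    finally have "v = k *s g + D *s w" by (simp add: f_eq)
    then have "D dvd v $ i - k * g $ i" for i by simp
    then show ?thesis by blast
  qed
  obtain k0 where "\<And>i. D dvd d $ i - k0 * g $ i" using L_g[OF d(2)] by blast
  then obtain j where j: "\<And>i. D dvd g $ i - j * d $ i"
    using divisor_generates_cyclic[OF D, of d k0 g] d_dvd_L[OF gL] by blast
  have "L = lattice"
  proof (intro equalityI subsetI)
    fix v assume "v \<in> L"
    then obtain k where k: "\<And>i. D dvd v $ i - k * g $ i" using L_g by blast
    have "D dvd v $ i - (k * j) * d $ i" for i
      using dvd_add[OF k[of i] dvd_mult[OF j[of i], of k]] by (simp add: algebra_simps)
    then show "v \<in> lattice" by (auto simp: lattice_def)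
  next
    fix v assume "v \<in> lattice"
    then obtain k where "\<And>i. D dvd v $ i - k * d $ i" by (auto simp: lattice_def)
    then have "v = k *s d + D *s (\<chi> i. (v $ i - k * d $ i) div D)"
      by (simp add: vec_eq_iff)
    moreover have "k *s d + D *s w \<in> L" for w
      using L_add[OF L_scale[OF d(2)] L_integral] .
    ultimately show "v \<in> L" by metis
  qed
  then have "f v \<in> pos A \<inter> int_points \<longleftrightarrow> v \<in> cone_points" for v
    by (auto simp: cone_points_def L_def f_pos)
  then have "pos A \<inter> int_points = f ` cone_points" using coords by blast
  then show ?thesis using that[of d] diagonal_lattice_axioms
    by (simp add: A_def D_def f_def)
qed

section \<open>The rank of the cone\<close>

theorem proposition5p2:
  fixes R :: "int ^ 'n ^ 'n"
  assumes "\<exists>y \<in> interior (pos (real_mat R)) \<inter> par (real_mat R).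
             (+) y ` (pos (real_mat R) \<inter> int_points) = interior (pos (real_mat R)) \<inter> int_points"
    and "finite {d :: nat. d dvd nat \<bar>det R\<bar>}"
    and "card {d :: nat. d dvd nat \<bar>det R\<bar>} \<le> 4"
    and "cyclic_group (lattice_quotient R)"
  shows "icr (pos (real_mat R)) = enat CARD('n)"
proof -
  let ?C = "pos (real_mat R)"
  have det: "det R \<noteq> 0"
  proof
    assume "det R = 0"
    then show False using assms(2) infinite_UNIV_nat by simp
  qed
  define D where "D = \<bar>det R\<bar>"
  define f where "f = of_scaled_coordinates D (real_mat R)"
  obtain d where "diagonal_lattice D d"
    and image: "?C \<inter> int_points = f ` diagonal_lattice.cone_points D d"
    using assms(1,4) interior_shift_coordinates[OF det] unfolding D_def f_def by metis
  interpret diagonal_lattice D d by fact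
  have f_add: "f (u + v) = f u + f v" for u v
    by (simp add: f_def of_scaled_coordinates_add)
  have "invertible (real_mat R)" using det by (simp add: invertible_det_nz det_real_mat)
  then have f_inj: "inj f"
    using inj_of_scaled_coordinates[of "real_mat R" D] D_pos by (simp add: f_def)
  have irr: "irreducibles (?C \<inter> int_points) = f ` irreducibles cone_points"
    unfolding image by (rule irreducibles_image[OF f_add f_inj])
  have few: "few_multiples (irreducibles (?C \<inter> int_points)) CARD('n) z" if "z \<in> ?C \<inter> int_points" for z
  proof -
    obtain v where v: "v \<in> cone_points" "z = f v" using \<open>z \<in> ?C \<inter> int_points\<close> image by blast
    have "few_multiples (irreducibles cone_points) CARD('n) v"
      using v(1) few_coordinate_values assms(2,3)
      by (intro cone_points_few_multiples) (simp_all add: D_def)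
    then show ?thesis unfolding irr v(2) by (rule few_multiples_image[OF f_add f_inj])
  qed
  have basis: "hilbert_basis ?C = irreducibles (?C \<inter> int_points)"
  proof (rule hilbert_basis_eq_irreducibles)
    fix x y assume "x \<in> ?C \<inter> int_points" "y \<in> ?C \<inter> int_points"
    then show "x + y \<in> ?C \<inter> int_points"
      unfolding image using cone_points_add by (auto simp: f_add[symmetric])
  next
    have "f 0 = 0" using f_add[of 0 0] by simp
    then show "0 \<in> ?C \<inter> int_points" unfolding image using zero_cone_points by force
  qed (use few in blast)
  have "icr ?C \<le> enat CARD('n)" by (rule icr_le) (use few in \<open>simp add: basis\<close>)
  moreover have "enat CARD('n) \<le> icr ?C"
    by (rule icr_ge_dimension[OF det]) (simp add: basis irr finite_irreducibles)
  ultimately show ?thesis by (rule antisym)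
qed

end
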